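(* Let $q$ be a power of a prime $p$, $s\ge1$, and let $N>1$ be an integer with $N-1\mid q^s-1$ and $p\mid N$. Let $\mathcal{A}=\{a_0=0<a_1<a_2<\cdots<a_z\}$ be the set of minimal representatives of the minimal cyclotomic sets $\mathfrak{I}_{a_i}$, $0\le i\le z$, of $\{0,1,\dots,N-1\}$ with respect to $q$. Let $0\le t\le z$, let $\Delta=\bigcup_{i=0}^{t-1}\mathfrak{I}_{a_i}\cup\{a_t\}$ and $\Delta''=\bigcup_{i=0}^{t}\mathfrak{I}_{a_i}$, and suppose that $\mathrm{RS}(N,\Delta'')\subset \mathrm{RS}(N,\Delta'')^\perp$. Then there is an EAQECC with parameters $[[n,\kappa,\geq\delta;c]]_q$, where $n=N+1$, $\kappa=N+1-2\left(\sum_{i=0}^t n_{a_i}\right)+c$, $\delta=a_t+2$, and $c\le 1$.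
   Context: Cyclotomic sets. Let $\mathbb{Z}_N=\{0\}\cup\mathbb{Z}/\langle N-1\rangle$, where the classes of $\mathbb{Z}/\langle N-1\rangle$ are represented by $\{1,\dots,N-1\}$ (so $0$ and $N-1$ are distinct and $q\cdot0=0$); $\mathbb{Z}_N$ is identified with $\{0,1,\dots,N-1\}$. For $z\in\mathbb{Z}_N$, $\mathfrak{I}_z=\{q^i\cdot z: i\ge 0\}$ is the minimal cyclotomic set of $z$ with respect to $q$, and $n_z=|\mathfrak{I}_z|$. A minimal representative of a minimal cyclotomic set is its least element. Codes. $Y_N=\{y\in\mathbb{F}_{q^s}: y^N=y\}$ ($N$ elements). For $\Gamma\subset\{0,\dots,N-1\}$, $\mathrm{RS}(N,\Gamma)\subset\mathbb{F}_{q^s}^N$ is the $\mathbb{F}_{q^s}$-linear code spanned by the vectors $(y^i)_{y\in Y_N}$, $i\in\Gamma$ (with $0^0=1$); $\perp$ is the Euclidean dual. EAQECC (entanglement-assisted quantum error-correcting code), standard definition. Let $H=\mathbb{C}^q$ with orthonormal basis $\{|x\rangle: x\in\mathbb{F}_q\}$ and $|\Phi\rangle=q^{-1/2}\sum_{x\in\mathbb{F}_q}|x\rangle|x\rangle\in H\otimes H$. An EAQECC encoding $\kappa$ qudits into $n$ qudits using $c$ maximally entangled pairs ($\kappa,c\ge0$, $\kappa+c\le n$) is a subspace $Q\subset H^{\otimes n}\otimes H^{\otimes c}$ of the form $\{(U\otimes I)(|\psi\rangle\otimes|0\rangle^{\otimes(n-\kappa-c)}\otimes|\Phi\rangle^{\otimes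 c}):|\psi\rangle\in H^{\otimes\kappa}\}$, where the first tensor factor $H^{\otimes n}$ consists of the $\kappa+(n-\kappa-c)$ sender qudits together with the sender's halves of the $c$ pairs, the last factor $H^{\otimes c}$ consists of the receiver's (noiseless) halves, and $U$ is a unitary on $H^{\otimes n}$. It has minimum distance at least $\delta$ if, with $P$ the orthogonal projector onto $Q$, $P(E\otimes I)P\in\mathbb{C}P$ for every operator $E$ on $H^{\otimes n}$ acting nontrivially on fewer than $\delta$ of the $n$ qudits. Parameters $[[n,\kappa,\ge\delta;c]]_q$ mean such a code with minimum distance at least $\delta$. *)

theory Defs
  imports
    Complex_Main
    "HOL-Computational_Algebra.Primes"
    "HOL-Library.Cardinality"
    "HOL-Library.Function_Algebras"
begin

section \<open>Cyclotomic sets\<close>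

text \<open>Multiplication of \<open>z\<close> by an integer \<open>k\<close> in \<open>{0} \<union> \<int>/(N-1)\<close>, whose elements are
  identified with \<open>{0,...,N-1}\<close>: the zero class of \<open>\<int>/(N-1)\<close> is represented by \<open>N-1\<close>, while
  \<open>0\<close> is the separate absorbing element.\<close>

definition zn_mult :: "nat \<Rightarrow> nat \<Rightarrow> nat \<Rightarrow> nat" where
  "zn_mult N k z =
     (if z = 0 then 0
      else if (k * z) mod (N - 1) = 0 then N - 1
      else (k * z) mod (N - 1))"

definition cyclotomic_set :: "nat \<Rightarrow> nat \<Rightarrow> nat \<Rightarrow> nat set" where
  "cyclotomic_set q N z = range (\<lambda>i::nat. zn_mult N (q ^ i) z)"

definition minimal_reps :: "nat \<Rightarrow> nat \<Rightarrow> nat set" where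
  "minimal_reps q N = (\<lambda>z. Min (cyclotomic_set q N z)) ` {..<N}"

section \<open>Evaluation codes\<close>

definition eval_points :: "nat \<Rightarrow> 'a::field set" where
  "eval_points N = {y. y ^ N = y}"

text \<open>The coordinates of a vector are indexed by \<open>eval_points N\<close>; vectors are functions on the
  whole field that vanish outside this set.\<close>

definition monomial_vec :: "nat \<Rightarrow> nat \<Rightarrow> 'a::field \<Rightarrow> 'a" where
  "monomial_vec N i = (\<lambda>y. if y \<in> eval_points N then y ^ i else 0)"

definition RS :: "nat \<Rightarrow> nat set \<Rightarrow> ('a::field \<Rightarrow> 'a) set" where
  "RS N \<Gamma> = module.span (\<lambda>c f y. c * f y) (monomial_vec N ` \<Gamma>)"

definition euclidean_dual :: "nat \<Rightarrow> ('a::field \<Rightarrow> 'a) set \<Rightarrow> ('a \<Rightarrow> 'a) set" where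
  "euclidean_dual N C =
     {v. (\<forall>y. y \<notin> eval_points N \<longrightarrow> v y = 0) \<and>
         (\<forall>w\<in>C. (\<Sum>y\<in>eval_points N. v y * w y) = 0)}"

section \<open>Systems of qudits\<close>

text \<open>The basis vectors of \<open>H = \<complex>\<^sup>q\<close> are labelled by the elements of a finite type \<open>'b\<close>, so those of
  the \<open>m\<close>-fold tensor power of \<open>H\<close> are labelled by the words of length \<open>m\<close>. A vector is given by its
  coordinates and an operator by its matrix entries, both extended by zero to words of other
  lengths. The tensor product of the \<open>m\<close>-fold with the \<open>k\<close>-fold tensor power is identified with the
  \<open>(m+k)\<close>-fold one by concatenation of words.\<close>

type_synonym 'b qvec = "'b list \<Rightarrow> complex"
type_synonym 'b qop = "'b list \<Rightarrow> 'b list \<Rightarrow> complex"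

definition words :: "nat \<Rightarrow> 'b list set" where
  "words m = {x. length x = m}"

definition qvecs :: "nat \<Rightarrow> 'b qvec set" where
  "qvecs m = {v. \<forall>x. x \<notin> words m \<longrightarrow> v x = 0}"

definition qops :: "nat \<Rightarrow> 'b qop set" where
  "qops m = {A. \<forall>x y. x \<notin> words m \<or> y \<notin> words m \<longrightarrow> A x y = 0}"

definition ket :: "'b list \<Rightarrow> 'b qvec" where
  "ket x = (\<lambda>y. if y = x then 1 else 0)"

definition op_apply :: "nat \<Rightarrow> 'b qop \<Rightarrow> 'b qvec \<Rightarrow> 'b qvec" where
  "op_apply m A v = (\<lambda>x. \<Sum>y\<in>words m. A x y * v y)"

definition op_comp :: "nat \<Rightarrow> 'b qop \<Rightarrow> 'b qop \<Rightarrow> 'b qop" where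
  "op_comp m A B = (\<lambda>x z. \<Sum>y\<in>words m. A x y * B y z)"

definition op_id :: "nat \<Rightarrow> 'b qop" where
  "op_id m = (\<lambda>x y. if x \<in> words m \<and> x = y then 1 else 0)"

definition op_adjoint :: "'b qop \<Rightarrow> 'b qop" where
  "op_adjoint A = (\<lambda>x y. cnj (A y x))"

definition unitary_op :: "nat \<Rightarrow> 'b qop \<Rightarrow> bool" where
  "unitary_op m U \<longleftrightarrow> U \<in> qops m \<and>
     op_comp m (op_adjoint U) U = op_id m \<and> op_comp m U (op_adjoint U) = op_id m"

definition orthogonal_projector :: "nat \<Rightarrow> 'b qvec set \<Rightarrow> 'b qop \<Rightarrow> bool" where
  "orthogonal_projector m Q P \<longleftrightarrow> P \<in> qops m \<and>
     op_comp m P P = P \<and> op_adjoint P = P \<and> op_apply m P ` qvecs m = Q"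

text \<open>In both definitions \<open>m\<close> is the number of qudits of the first tensor factor.\<close>

definition vec_tensor :: "nat \<Rightarrow> 'b qvec \<Rightarrow> 'b qvec \<Rightarrow> 'b qvec" where
  "vec_tensor m u v = (\<lambda>x. u (take m x) * v (drop m x))"

definition op_tensor :: "nat \<Rightarrow> 'b qop \<Rightarrow> 'b qop \<Rightarrow> 'b qop" where
  "op_tensor m A B = (\<lambda>x y. A (take m x) (take m y) * B (drop m x) (drop m y))"

definition max_entangled :: "'b::finite qvec" where
  "max_entangled =
     (\<lambda>w. complex_of_real (1 / sqrt (real CARD('b))) * (\<Sum>x\<in>UNIV. ket [x, x] w))"

text \<open>The tensor product of \<open>c\<close> maximally entangled pairs, with its factors regrouped: first the
  \<open>c\<close> sender halves, then the \<open>c\<close> receiver halves; pair \<open>i\<close> occupies the positions \<open>i\<close> and \<open>c+i\<close>.\<close>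

definition max_entangled_pairs :: "nat \<Rightarrow> 'b::finite qvec" where
  "max_entangled_pairs c =
     (\<lambda>w. if w \<in> words (2 * c) then (\<Prod>i<c. max_entangled [w ! i, w ! (c + i)]) else 0)"

text \<open>\<open>E\<close> is of the form \<open>E' \<otimes> I\<close> with \<open>E'\<close> acting on the qudits in the positions \<open>S\<close>.\<close>

definition acts_only_on :: "nat \<Rightarrow> nat set \<Rightarrow> 'b qop \<Rightarrow> bool" where
  "acts_only_on n S E \<longleftrightarrow>
     (\<exists>E'. E = (\<lambda>x y. if x \<in> words n \<and> y \<in> words n \<and> nths x (- S) = nths y (- S)
                       then E' (nths x S) (nths y S) else 0))"

section \<open>Entanglement-assisted codes\<close>

definition eaqecc_encode ::
    "nat \<Rightarrow> nat \<Rightarrow> nat \<Rightarrow> 'b qop \<Rightarrow> 'b::{finite,zero} qvec \<Rightarrow> 'b qvec" where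
  "eaqecc_encode n \<kappa> c U \<psi> =
     op_apply (n + c) (op_tensor n U (op_id c))
       (vec_tensor \<kappa> \<psi>
         (vec_tensor (n - \<kappa> - c) (ket (replicate (n - \<kappa> - c) 0)) (max_entangled_pairs c)))"

definition eaqecc :: "nat \<Rightarrow> nat \<Rightarrow> nat \<Rightarrow> 'b::{finite,zero} qvec set \<Rightarrow> bool" where
  "eaqecc n \<kappa> c Q \<longleftrightarrow> \<kappa> + c \<le> n \<and>
     (\<exists>U. unitary_op n U \<and> Q = eaqecc_encode n \<kappa> c U ` qvecs \<kappa>)"

definition min_distance_ge :: "nat \<Rightarrow> nat \<Rightarrow> nat \<Rightarrow> 'b qvec set \<Rightarrow> bool" where
  "min_distance_ge n c \<delta> Q \<longleftrightarrow>
     (\<exists>P. orthogonal_projector (n + c) Q P \<and>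
        (\<forall>E S. S \<subseteq> {..<n} \<and> card S < \<delta> \<and> acts_only_on n S E \<longrightarrow>
           (\<exists>\<mu>. op_comp (n + c) P (op_comp (n + c) (op_tensor n E (op_id c)) P)
                  = (\<lambda>x y. \<mu> * P x y))))"

text \<open>\<open>Q\<close> has parameters \<open>[[n, \<kappa>, \<ge>\<delta>; c]]\<close> over the alphabet \<open>'b\<close>.\<close>

definition eaqecc_params :: "nat \<Rightarrow> nat \<Rightarrow> nat \<Rightarrow> nat \<Rightarrow> 'b::{finite,zero} qvec set \<Rightarrow> bool" where
  "eaqecc_params n \<kappa> \<delta> c Q \<longleftrightarrow> eaqecc n \<kappa> c Q \<and> min_distance_ge n c \<delta> Q"

end

theory Submission
  imports Defs "HOL-Computational_Algebra.Polynomial" "HOL-Library.FuncSet"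
begin

text \<open>Let \<open>F\<close> be the subfield of order \<open>q\<close> of the big field and \<open>m\<close> the total size of the
  cyclotomic sets in \<open>\<Delta>''\<close>. Evaluate the traces of the polynomials \<open>\<Sum>\<^sub>j c\<^sub>j * y ^ a j\<close> (\<open>j \<le> t\<close>) at
  the \<open>N\<close> points, and append the trace of \<open>c\<^sub>t\<close> as a coordinate at infinity. The resulting code
  \<open>R\<close> over \<open>F\<close> of length \<open>N + 1\<close> has dimension at most \<open>m\<close>. Self-orthogonality of the
  evaluation code says that the inner product of two words of \<open>R\<close> is the product of their
  coordinates at infinity, a form of rank one; this is why one entangled pair suffices. As
  \<open>0, \<dots>, a t\<close> all lie in \<open>\<Delta>''\<close>, interpolation (with a prescribed leading coefficient if the
  point at infinity is involved) shows that \<open>R\<close> projects onto any \<open>a t + 1\<close> coordinates.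

  If \<open>R\<^sub>0\<close> is the subcode of \<open>R\<close> vanishing at infinity and \<open>u\<close> runs through representatives of
  the dual of \<open>R\<close> modulo \<open>R\<^sub>0\<close>, the code is spanned by the states
  \<open>\<Sum>\<^sub>g\<^sub>\<in>\<^sub>R |u + g\<rangle>|g(\<infinity>)\<rangle>\<close>. An error on at most \<open>a t + 1\<close> qudits cannot connect two different basis
  words that occur in these states, because the dual of \<open>R\<close> contains no nonzero word of such a
  small weight; and its diagonal part has the same mean on all of them, because \<open>R\<close> is uniformly
  distributed on the qudits concerned.\<close>

section \<open>Extending orthonormal systems\<close>

lemma orthonormal_columns_extend:
  fixes f :: "'i \<Rightarrow> 'i \<Rightarrow> real"
  assumes I: "finite I" and J: "J \<subseteq> I"
    and orth: "\<And>j k. j \<in> J \<Longrightarrow> k \<in> J \<Longrightarrow> (\<Sum>x\<in>I. f j x * f k x) = (if j = k then 1 else 0)"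
  shows "\<exists>A. (\<forall>j\<in>J. \<forall>x\<in>I. A x j = f j x) \<and>
    (\<forall>j\<in>I. \<forall>k\<in>I. (\<Sum>x\<in>I. A x j * A x k) = (if j = k then 1 else 0)) \<and>
    (\<forall>x\<in>I. \<forall>y\<in>I. (\<Sum>j\<in>I. A x j * A y j) = (if x = y then 1 else 0))"
proof -
  have "finite J" using I J finite_subset by blast
  then show ?thesis using J orth
  proof (induction J rule: finite_induct)
    case empty
    show ?case
      by (rule exI[where x = "\<lambda>x j. if x = j then 1 else 0"])
        (use I in \<open>auto simp: if_distrib[where f = "\<lambda>u. u * _"] sum.delta cong: if_cong\<close>)
  next
    case (insert i J)
    obtain A :: "'i \<Rightarrow> 'i \<Rightarrow> real"
      where A_J: "\<And>j x. j \<in> J \<Longrightarrow> x \<in> I \<Longrightarrow> A x j = f j x"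
        and A_col: "\<And>j k. j \<in> I \<Longrightarrow> k \<in> I \<Longrightarrow> (\<Sum>x\<in>I. A x j * A x k) = (if j = k then 1 else 0)"
        and A_row: "\<And>x y. x \<in> I \<Longrightarrow> y \<in> I \<Longrightarrow> (\<Sum>j\<in>I. A x j * A y j) = (if x = y then 1 else 0)"
    proof -
      have "J \<subseteq> I" using insert.prems by auto
      with insert.IH insert.prems(2) show ?thesis
        using that by (smt (verit, ccfv_threshold) insertCI)
    qed
    have i: "i \<in> I" using insert.prems by auto
    \<comment> \<open>The reflection along \<open>v\<close> exchanges the column \<open>i\<close> of \<open>A\<close> with \<open>f i\<close> and fixes the columns
      in \<open>J\<close>.\<close>
    define v where "v = (\<lambda>x. A x i - f i x)"
    define w where "w = (\<lambda>j. \<Sum>x\<in>I. v x * A x j)"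
    define d where "d = (\<Sum>x\<in>I. v x * v x)"
    show ?case
    proof (cases "d = 0")
      case True
      then have "\<And>x. x \<in> I \<Longrightarrow> v x = 0"
        unfolding d_def using I by (simp add: sum_nonneg_eq_0_iff)
      then have "\<And>x. x \<in> I \<Longrightarrow> A x i = f i x" by (simp add: v_def)
      then show ?thesis using A_J A_col A_row by (intro exI[where x = A]) auto
    next
      case False
      define B where "B = (\<lambda>x j. A x j - 2 / d * v x * w j)"
      have ff: "(\<Sum>x\<in>I. f i x * f i x) = 1" using insert.prems(2)[of i i] by simp
      have AA: "(\<Sum>x\<in>I. A x i * A x i) = 1" using A_col[OF i i] by simp
      \<comment> \<open>For unit vectors the squared distance \<open>d\<close> is twice
        \<open>1 - <A i, f i>\<close>, so the reflection subtracts exactly \<open>v\<close> from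
        column \<open>i\<close>.\<close>
      have w_i: "w i = d / 2"
      proof -
        have "d = (\<Sum>x\<in>I. A x i * A x i) - 2 * (\<Sum>x\<in>I. A x i * f i x) + (\<Sum>x\<in>I. f i x * f i x)"
          by (simp add: d_def v_def algebra_simps sum.distrib sum_subtractf sum_distrib_left)
        moreover have "w i = (\<Sum>x\<in>I. A x i * A x i) - (\<Sum>x\<in>I. A x i * f i x)"
          by (simp add: w_def v_def algebra_simps sum_subtractf)
        ultimately show ?thesis using ff AA by simp
      qed
      have w_J: "w j = 0" if "j \<in> J" for j
      proof -
        have "j \<in> I" "j \<noteq> i" using that insert by auto
        have "w j = (\<Sum>x\<in>I. A x i * A x j) - (\<Sum>x\<in>I. f i x * A x j)"
          unfolding w_def v_def by (simp add: algebra_simps sum_subtractf)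
        also have "(\<Sum>x\<in>I. f i x * A x j) = (\<Sum>x\<in>I. f i x * f j x)"
          using A_J[OF that] by (intro sum.cong) auto
        finally show ?thesis
          using A_col[OF i \<open>j \<in> I\<close>] insert.prems(2)[of i j] that \<open>j \<noteq> i\<close> by auto
      qed
      \<comment> \<open>Completeness: the rows of \<open>A\<close> are orthonormal as well, so
        \<open>v\<close> is recovered from its coefficients \<open>w\<close> with respect to the
        columns.\<close>
      have vA: "(\<Sum>j\<in>I. w j * A y j) = v y" if "y \<in> I" for y
      proof -
        have "(\<Sum>j\<in>I. w j * A y j) = (\<Sum>x\<in>I. v x * (\<Sum>j\<in>I. A x j * A y j))"
          unfolding w_def sum_distrib_left sum_distrib_right
          by (subst sum.swap) (simp add: mult_ac)
        also have "\<dots> = (\<Sum>x\<in>I. if x = y then v x else 0)"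
          by (intro sum.cong refl) (use A_row that in auto)
        finally show ?thesis using that I by simp
      qed
      have ww: "(\<Sum>j\<in>I. w j * w j) = d"
      proof -
        have "(\<Sum>j\<in>I. w j * w j) = (\<Sum>j\<in>I. \<Sum>x\<in>I. w j * (v x * A x j))"
          by (simp add: w_def sum_distrib_left)
        also have "\<dots> = (\<Sum>x\<in>I. \<Sum>j\<in>I. w j * (v x * A x j))" by (rule sum.swap)
        also have "\<dots> = (\<Sum>x\<in>I. v x * (\<Sum>j\<in>I. w j * A x j))"
          by (simp add: sum_distrib_left mult_ac)
        also have "\<dots> = d" unfolding d_def using vA by (intro sum.cong) auto
        finally show ?thesis .
      qed
      have "(\<Sum>x\<in>I. B x j * B x k) = (if j = k then 1 else 0)" if "j \<in> I" "k \<in> I" for j k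
      proof -
        have "(\<Sum>x\<in>I. B x j * B x k) = (\<Sum>x\<in>I. A x j * A x k) - 2 / d * w k * (\<Sum>x\<in>I. v x * A x j)
            - 2 / d * w j * (\<Sum>x\<in>I. v x * A x k) + 4 / d / d * w j * w k * (\<Sum>x\<in>I. v x * v x)"
          unfolding B_def
          by (simp add: algebra_simps sum.distrib sum_subtractf sum_distrib_left sum_divide_distrib)
        then have "(\<Sum>x\<in>I. B x j * B x k) = (\<Sum>x\<in>I. A x j * A x k) - 2 / d * w k * w j
            - 2 / d * w j * w k + 4 / d / d * w j * w k * d"
          by (simp only: w_def d_def)
        then show ?thesis using A_col[OF that] False by (simp add: field_simps)
      qed
      moreover have "(\<Sum>j\<in>I. B x j * B y j) = (if x = y then 1 else 0)" if "x \<in> I" "y \<in> I" for x y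
      proof -
        have "(\<Sum>j\<in>I. B x j * B y j) = (\<Sum>j\<in>I. A x j * A y j) - 2 / d * v x * (\<Sum>j\<in>I. w j * A y j)
            - 2 / d * v y * (\<Sum>j\<in>I. w j * A x j) + 4 / d / d * v x * v y * (\<Sum>j\<in>I. w j * w j)"
          unfolding B_def
          by (simp add: algebra_simps sum.distrib sum_subtractf sum_distrib_left sum_divide_distrib)
        then show ?thesis using A_row[OF that] vA[OF that(1)] vA[OF that(2)] ww False
          by (simp add: field_simps)
      qed
      moreover have "B x j = f j x" if "j \<in> insert i J" "x \<in> I" for x j
      proof (cases "j = i")
        case True
        then show ?thesis using \<open>d \<noteq> 0\<close> by (simp add: B_def w_i) (simp add: v_def)
      next
        case False
        then show ?thesis using that w_J A_J by (simp add: B_def)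
      qed
      ultimately show ?thesis by (intro exI[where x = B]) auto
    qed
  qed
qed

section \<open>Words, selected letters and a single entangled pair\<close>

lemma finite_words [simp]: "finite (words n :: 'b::finite list set)"
  using finite_lists_length_eq[of "UNIV :: 'b set" n] by (simp add: words_def)

lemma sum_words_Suc:
  "(\<Sum>x\<in>words (Suc n). f x) = (\<Sum>w\<in>words n. \<Sum>b\<in>UNIV. f (w @ [b :: 'b::finite]))"
proof -
  have "(\<Sum>x\<in>words (Suc n). f x) = (\<Sum>(w, b)\<in>words n \<times> UNIV. f (w @ [b]))"
    by (rule sum.reindex_bij_witness[where j = "\<lambda>x. (butlast x, last x)" and i = "\<lambda>(w, b). w @ [b]"])
      (auto simp: words_def length_Suc_conv_rev)
  then show ?thesis by (simp add: sum.cartesian_product)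
qed

text \<open>How many letters are selected depends only on the length, so both lists split in step.
  The lemma turns the \<open>nths\<close> of \<open>acts_only_on\<close> into a condition letter by
  letter.\<close>

lemma nths_eq_iff:
  assumes "length x = length y"
  shows "nths x S = nths y S \<longleftrightarrow> (\<forall>i<length x. i \<in> S \<longrightarrow> x ! i = y ! i)"
  using assms
proof (induction x y arbitrary: S rule: list_induct2)
  case (Cons a x b y)
  have "length (nths x {j. Suc j \<in> S}) = length (nths y {j. Suc j \<in> S})"
    using Cons.hyps by (simp add: length_nths)
  then show ?case using Cons by (auto simp: nths_Cons All_less_Suc2)
qed auto

lemma max_entangled_pair:
  "max_entangled [x, y :: 'b::finite] = (if x = y then complex_of_real (1 / sqrt (real CARD('b))) else 0)"
proof -
  have "(\<Sum>u\<in>UNIV. ket [u, u] [x, y]) = (\<Sum>u\<in>UNIV. if u = x then (if x = y then 1 else 0) else 0)"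
    by (intro sum.cong) (auto simp: ket_def)
  then show ?thesis by (simp add: max_entangled_def)
qed

section \<open>Entanglement-assisted codes from families of disjoint supports\<close>

text \<open>The code is spanned by the states \<open>\<Sum>\<^sub>b \<Sum>\<^sub>w |w\<rangle>|b\<rangle>\<close> with \<open>w \<in> X k b\<close>, one for each word \<open>k\<close> of
  length \<open>\<kappa>\<close>. The last two assumptions are the Knill-Laflamme conditions for the off-diagonal and
  for the diagonal part of an error on the qudits in \<open>S\<close>.\<close>

locale coset_family =
  fixes n \<kappa> K \<delta> :: nat and X :: "'b::{finite,zero} list \<Rightarrow> 'b \<Rightarrow> 'b list set"
  assumes \<kappa>_less: "\<kappa> + 1 \<le> n"
    and K_pos: "K > 0"
    and X_words: "k \<in> words \<kappa> \<Longrightarrow> X k b \<subseteq> words n"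
    and card_X: "k \<in> words \<kappa> \<Longrightarrow> card (X k b) = K"
    and X_disjoint: "\<lbrakk>k \<in> words \<kappa>; k' \<in> words \<kappa>; w \<in> X k b; w \<in> X k' b'\<rbrakk> \<Longrightarrow> k = k' \<and> b = b'"
    and X_detect: "\<lbrakk>S \<subseteq> {..<n}; card S < \<delta>; k \<in> words \<kappa>; k' \<in> words \<kappa>; w \<in> X k b; w' \<in> X k' b;
          \<And>i. i < n \<Longrightarrow> i \<notin> S \<Longrightarrow> w ! i = w' ! i\<rbrakk> \<Longrightarrow> w = w'"
    and X_uniform: "\<lbrakk>S \<subseteq> {..<n}; card S < \<delta>; k \<in> words \<kappa>; k' \<in> words \<kappa>\<rbrakk> \<Longrightarrow>
          \<exists>h. bij_betw h {(w, b). w \<in> X k b} {(w, b). w \<in> X k' b} \<and>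
            (\<forall>w b. w \<in> X k b \<longrightarrow> (\<forall>i\<in>S. fst (h (w, b)) ! i = w ! i))"
begin

section \<open>Basis states, their projector and the Knill-Laflamme conditions\<close>

definition Z :: "'b list \<Rightarrow> 'b list set" where
  "Z k = (\<lambda>(w, b). w @ [b]) ` {(w, b). w \<in> X k b}"

definition M :: nat where "M = CARD('b) * K"

definition ind :: "'b list \<Rightarrow> 'b list \<Rightarrow> complex" where
  "ind k x = (if x \<in> Z k then 1 else 0)"

definition state :: "'b qvec \<Rightarrow> 'b qvec" where
  "state \<psi> x = (\<Sum>k\<in>words \<kappa>. \<psi> k * ind k x) / complex_of_real (sqrt (real M))"

text \<open>The normalized indicator vectors of the sets \<open>Z k\<close> are orthonormal, these
  sets being disjoint with \<open>M\<close> elements each; this is the sum of the rank one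
  projectors onto them.\<close>

definition Proj :: "'b qop" where
  "Proj x y = (\<Sum>k\<in>words \<kappa>. ind k x * ind k y) / of_nat M"

lemma M_pos: "M > 0"
  using K_pos by (simp add: M_def)

lemma snoc_in_Z: "w @ [b] \<in> Z k \<longleftrightarrow> w \<in> X k b"
  by (auto simp: Z_def)

lemma Z_words: "k \<in> words \<kappa> \<Longrightarrow> Z k \<subseteq> words (Suc n)"
  using X_words by (fastforce simp: Z_def words_def)

lemma finite_Z: "k \<in> words \<kappa> \<Longrightarrow> finite (Z k)"
  using Z_words finite_words finite_subset by metis

lemma card_Z: assumes "k \<in> words \<kappa>" shows "card (Z k) = M"
proof -
  have fin: "finite (X k b)" for b
    using X_words[OF assms] finite_words finite_subset by metis
  have "{(w, b). w \<in> X k b} = (\<lambda>(b, w). (w, b)) ` Sigma UNIV (X k)" by auto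
  then have "card {(w, b). w \<in> X k b} = card (Sigma UNIV (X k))"
    by (simp add: card_image inj_on_def)
  also have "\<dots> = M" using card_X[OF assms] fin by (simp add: M_def)
  finally show ?thesis
    unfolding Z_def by (subst card_image) (auto simp: inj_on_def)
qed

lemma Z_disjoint:
  assumes "k \<in> words \<kappa>" "k' \<in> words \<kappa>" "x \<in> Z k" "x \<in> Z k'"
  shows "k = k'"
  using assms X_disjoint unfolding Z_def by fastforce

lemma ind_outside: "k \<in> words \<kappa> \<Longrightarrow> x \<notin> words (Suc n) \<Longrightarrow> ind k x = 0"
  using Z_words by (auto simp: ind_def)

lemma sum_ind: "k \<in> words \<kappa> \<Longrightarrow> (\<Sum>y\<in>words (Suc n). ind k y * f y) = (\<Sum>y\<in>Z k. f y)"
  by (rule sum.mono_neutral_cong_right) (use Z_words in \<open>auto simp: ind_def\<close>)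

lemma sum_ind_ind:
  assumes "k \<in> words \<kappa>" "k' \<in> words \<kappa>"
  shows "(\<Sum>y\<in>words (Suc n). ind k y * ind k' y) = (if k = k' then of_nat M else 0)"
  unfolding sum_ind[OF assms(1)]
  using assms Z_disjoint card_Z by (auto simp: ind_def intro!: sum.neutral)

lemma Proj_apply:
  "op_apply (Suc n) Proj v x = (\<Sum>k\<in>words \<kappa>. ind k x * (\<Sum>y\<in>Z k. v y)) / of_nat M"
proof -
  have "op_apply (Suc n) Proj v x
      = (\<Sum>y\<in>words (Suc n). \<Sum>k\<in>words \<kappa>. ind k x * (ind k y * v y)) / of_nat M"
    by (simp add: op_apply_def Proj_def sum_divide_distrib sum_distrib_right mult.assoc)
  also have "\<dots> = (\<Sum>k\<in>words \<kappa>. ind k x * (\<Sum>y\<in>words (Suc n). ind k y * v y)) / of_nat M"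
    by (subst sum.swap) (simp add: sum_distrib_left)
  finally show ?thesis by (simp add: sum_ind)
qed

text \<open>As \<open>Proj\<close> is a sum of rank one terms, the compression of \<open>A\<close>
  only sees the sums of its entries over the blocks given by \<open>Z k\<close> and
  \<open>Z k'\<close>. The Knill-Laflamme conditions become statements about these block
  sums.\<close>

lemma Proj_comp:
  "op_comp (Suc n) Proj (op_comp (Suc n) A Proj) x z =
    (\<Sum>k\<in>words \<kappa>. \<Sum>k'\<in>words \<kappa>. ind k x * ind k' z * (\<Sum>y\<in>Z k. \<Sum>y'\<in>Z k'. A y y')) / (of_nat M)\<^sup>2"
proof -
  have 1: "op_comp (Suc n) A Proj y z = (\<Sum>k'\<in>words \<kappa>. ind k' z * (\<Sum>y'\<in>Z k'. A y y')) / of_nat M" for y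
  proof -
    have "op_comp (Suc n) A Proj y z
        = (\<Sum>y'\<in>words (Suc n). \<Sum>k'\<in>words \<kappa>. ind k' z * (ind k' y' * A y y')) / of_nat M"
      by (simp add: op_comp_def Proj_def sum_divide_distrib sum_distrib_left mult_ac)
    also have "\<dots> = (\<Sum>k'\<in>words \<kappa>. ind k' z * (\<Sum>y'\<in>words (Suc n). ind k' y' * A y y')) / of_nat M"
      by (subst sum.swap) (simp add: sum_distrib_left)
    finally show ?thesis by (simp add: sum_ind)
  qed
  have "op_comp (Suc n) Proj (op_comp (Suc n) A Proj) x z
      = op_apply (Suc n) Proj (\<lambda>y. op_comp (Suc n) A Proj y z) x"
    by (simp add: op_comp_def op_apply_def)
  also have "\<dots> = (\<Sum>k\<in>words \<kappa>. ind k x * (\<Sum>k'\<in>words \<kappa>. ind k' z * (\<Sum>y\<in>Z k. \<Sum>y'\<in>Z k'. A y y'))) / (of_nat M)\<^sup>2"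
    unfolding Proj_apply 1 power2_eq_square
    by (subst sum_divide_distrib[symmetric], subst sum.swap)
      (simp add: sum_distrib_left sum_divide_distrib)
  finally show ?thesis by (simp add: sum_distrib_left mult.assoc)
qed

lemma Proj_idem: "op_comp (Suc n) Proj Proj = Proj"
proof (intro ext)
  fix x z
  have "op_comp (Suc n) Proj Proj x z = op_apply (Suc n) Proj (\<lambda>y. Proj y z) x"
    by (simp add: op_comp_def op_apply_def)
  also have "\<dots> = (\<Sum>k\<in>words \<kappa>. ind k x * (\<Sum>y\<in>words (Suc n). ind k y * Proj y z)) / of_nat M"
    by (simp add: Proj_apply sum_ind)
  also have "\<dots> = (\<Sum>k\<in>words \<kappa>. ind k x * ind k z) / of_nat M"
  proof -
    have "(\<Sum>y\<in>words (Suc n). ind k y * Proj y z) = ind k z" if k: "k \<in> words \<kappa>" for k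
    proof -
      have "(\<Sum>y\<in>words (Suc n). ind k y * Proj y z)
          = (\<Sum>y\<in>words (Suc n). \<Sum>k'\<in>words \<kappa>. ind k' z * (ind k y * ind k' y)) / of_nat M"
        by (simp add: Proj_def sum_divide_distrib sum_distrib_left mult_ac)
      also have "\<dots> = (\<Sum>k'\<in>words \<kappa>. ind k' z * (\<Sum>y\<in>words (Suc n). ind k y * ind k' y)) / of_nat M"
        by (subst sum.swap) (simp add: sum_distrib_left)
      also have "\<dots> = (\<Sum>k'\<in>words \<kappa>. if k' = k then ind k' z * of_nat M else 0) / of_nat M"
        by (intro arg_cong2[where f = "(/)"] sum.cong refl) (use k in \<open>auto simp: sum_ind_ind\<close>)
      also have "\<dots> = ind k z" using k M_pos by simp
      finally show ?thesis .
    qed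
    then show ?thesis by simp
  qed
  finally show "op_comp (Suc n) Proj Proj x z = Proj x z" by (simp add: Proj_def)
qed

lemma Proj_image: "op_apply (Suc n) Proj ` qvecs (Suc n) = state ` qvecs \<kappa>"
proof (intro equalityI subsetI)
  have s: "complex_of_real (sqrt (real M)) * complex_of_real (sqrt (real M)) = of_nat M"
    by (metis of_real_mult of_real_of_nat_eq real_sqrt_mult_self abs_of_nat)
  have s0: "complex_of_real (sqrt (real M)) \<noteq> 0" using M_pos by simp
  fix u assume "u \<in> op_apply (Suc n) Proj ` qvecs (Suc n)"
  then obtain v where u: "u = op_apply (Suc n) Proj v" by blast
  define S where "S k = (\<Sum>y\<in>Z k. v y)" for k
  \<comment> \<open>The coefficients are the inner products of \<open>v\<close> with the normalized
    indicator vectors.\<close>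
  define \<psi> where "\<psi> k = (if k \<in> words \<kappa> then S k / complex_of_real (sqrt (real M)) else 0)" for k
  have "u x = state \<psi> x" for x
  proof -
    have "state \<psi> x = (\<Sum>k\<in>words \<kappa>. S k / complex_of_real (sqrt (real M)) * ind k x)
        / complex_of_real (sqrt (real M))"
      by (simp add: state_def \<psi>_def)
    also have "\<dots> = u x"
      unfolding u Proj_apply s[symmetric] S_def[symmetric] by (simp add: sum_divide_distrib mult_ac)
    finally show ?thesis by simp
  qed
  moreover have "\<psi> \<in> qvecs \<kappa>" by (simp add: \<psi>_def qvecs_def)
  ultimately show "u \<in> state ` qvecs \<kappa>" by blast
next
  fix u assume "u \<in> state ` qvecs \<kappa>"
  then obtain \<psi> where u: "u = state \<psi>" by blast
  have "op_apply (Suc n) Proj u x = u x" for x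
  proof -
    have "(\<Sum>y\<in>Z k. u y) = of_nat M * \<psi> k / complex_of_real (sqrt (real M))" if k: "k \<in> words \<kappa>" for k
    proof -
      have "(\<Sum>y\<in>Z k. u y) = (\<Sum>y\<in>words (Suc n). ind k y * u y)" using k by (simp add: sum_ind)
      also have "\<dots> = (\<Sum>y\<in>words (Suc n). \<Sum>k'\<in>words \<kappa>. \<psi> k' * (ind k y * ind k' y)) / complex_of_real (sqrt (real M))"
        by (simp add: u state_def sum_divide_distrib sum_distrib_left mult_ac)
      also have "\<dots> = (\<Sum>k'\<in>words \<kappa>. \<psi> k' * (\<Sum>y\<in>words (Suc n). ind k y * ind k' y)) / complex_of_real (sqrt (real M))"
        by (subst sum.swap) (simp add: sum_distrib_left)
      also have "\<dots> = (\<Sum>k'\<in>words \<kappa>. if k' = k then \<psi> k' * of_nat M else 0) / complex_of_real (sqrt (real M))"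
        by (intro arg_cong2[where f = "(/)"] sum.cong refl) (use k in \<open>auto simp: sum_ind_ind\<close>)
      also have "\<dots> = of_nat M * \<psi> k / complex_of_real (sqrt (real M))" using k by simp
      finally show ?thesis .
    qed
    then have "op_apply (Suc n) Proj u x
        = (\<Sum>k\<in>words \<kappa>. ind k x * (of_nat M * \<psi> k / complex_of_real (sqrt (real M)))) / of_nat M"
      by (simp add: Proj_apply)
    also have "\<dots> = u x"
      using M_pos by (simp add: u state_def sum_divide_distrib mult_ac)
    finally show ?thesis .
  qed
  then have "u = op_apply (Suc n) Proj u" by auto
  moreover have "u \<in> qvecs (Suc n)"
    by (simp add: u qvecs_def state_def ind_outside)
  ultimately show "u \<in> op_apply (Suc n) Proj ` qvecs (Suc n)" by blast
qed

lemma orthogonal_projector_Proj: "orthogonal_projector (Suc n) (state ` qvecs \<kappa>) Proj"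
proof -
  have "Proj \<in> qops (Suc n)"
    by (auto simp: qops_def Proj_def ind_outside)
  moreover have "op_adjoint Proj = Proj"
    by (auto simp: fun_eq_iff op_adjoint_def Proj_def ind_def intro!: sum.cong)
  ultimately show ?thesis
    by (simp add: orthogonal_projector_def Proj_idem Proj_image)
qed

text \<open>On the supports the error reduces to its diagonal, because all other entries between
  words of \<open>Z k\<close> and \<open>Z k'\<close> vanish by \<open>X_detect\<close>. The
  diagonal sums \<open>T k\<close> do not depend on \<open>k\<close> by \<open>X_uniform\<close>,
  and \<open>Proj_comp\<close> then yields a multiple of \<open>Proj\<close>.\<close>

lemma min_distance: "min_distance_ge n 1 \<delta> (state ` qvecs \<kappa>)"
  unfolding min_distance_ge_def
proof (intro exI[where x = Proj] conjI allI impI)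
  show "orthogonal_projector (n + 1) (state ` qvecs \<kappa>) Proj"
    using orthogonal_projector_Proj by simp
next
  fix E :: "'b qop" and S
  assume ES: "S \<subseteq> {..<n} \<and> card S < \<delta> \<and> acts_only_on n S E"
  then obtain E' where E: "E = (\<lambda>x y. if x \<in> words n \<and> y \<in> words n \<and> nths x (- S) = nths y (- S)
      then E' (nths x S) (nths y S) else 0)"
    unfolding acts_only_on_def by blast
  let ?A = "op_tensor n E (op_id 1)"
  have A: "?A (w @ [b]) (w' @ [b']) = (if b = b' then E w w' else 0)"
    if "w \<in> words n" "w' \<in> words n" for w w' b b'
    using that by (simp add: op_tensor_def op_id_def words_def)
  have diag: "E w w = E' (nths w S) (nths w S)" if "w \<in> words n" for w
    using that by (simp add: E)
  \<comment> \<open>A nonzero entry forces equal receiver letters, since the error is the identity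
    there, and agreement outside \<open>S\<close>.\<close>
  have off: "?A y y' = 0" if kk: "k \<in> words \<kappa>" "k' \<in> words \<kappa>" "y \<in> Z k" "y' \<in> Z k'" "y \<noteq> y'" for k k' y y'
  proof (rule ccontr)
    assume nz: "?A y y' \<noteq> 0"
    obtain w b w' b' where y: "y = w @ [b]" "y' = w' @ [b']" "w \<in> X k b" "w' \<in> X k' b'"
      using kk by (auto simp: Z_def)
    have w: "w \<in> words n" "w' \<in> words n" using y kk X_words by blast+
    have b: "b = b'" and "E w w' \<noteq> 0" using nz A[OF w] y by (auto split: if_splits)
    then have "nths w (- S) = nths w' (- S)" by (auto simp: E split: if_splits)
    then have "w ! i = w' ! i" if "i < n" "i \<notin> S" for i
      using w that nths_eq_iff[of w w' "- S"] by (auto simp: words_def)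
    then have "w = w'" using X_detect[of S k k' w b w'] ES kk y b by auto
    then show False using kk y b by simp
  qed
  define T where "T k = (\<Sum>y\<in>Z k. ?A y y)" for k
  have sumA: "(\<Sum>y\<in>Z k. \<Sum>y'\<in>Z k'. ?A y y') = (if k = k' then T k else 0)"
    if k: "k \<in> words \<kappa>" "k' \<in> words \<kappa>" for k k'
  proof (cases "k = k'")
    case True
    have "(\<Sum>y'\<in>Z k. ?A y y') = ?A y y" if "y \<in> Z k" for y
    proof -
      have "(\<Sum>y'\<in>Z k. ?A y y') = (\<Sum>y'\<in>Z k. if y' = y then ?A y y else 0)"
        using off[OF k(1) k(1) that] by (intro sum.cong) auto
      then show ?thesis using that finite_Z[OF k(1)] by simp
    qed
    then show ?thesis using True by (simp add: T_def)
  next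
    case False
    then have "y \<noteq> y'" if "y \<in> Z k" "y' \<in> Z k'" for y y'
      using Z_disjoint k that by blast
    then show ?thesis using off[OF k] False by (simp add: sum.neutral)
  qed
  have T_pairs: "T k = (\<Sum>(w, b)\<in>{(w, b). w \<in> X k b}. E' (nths w S) (nths w S))" if "k \<in> words \<kappa>" for k
  proof -
    have "T k = (\<Sum>(w, b)\<in>{(w, b). w \<in> X k b}. ?A (w @ [b]) (w @ [b]))"
      unfolding T_def Z_def by (subst sum.reindex) (auto simp: inj_on_def case_prod_unfold)
    also have "\<dots> = (\<Sum>(w, b)\<in>{(w, b). w \<in> X k b}. E' (nths w S) (nths w S))"
    proof (intro sum.cong refl, clarify)
      fix w b assume "w \<in> X k b"
      then have "w \<in> words n" using X_words[OF that] by blast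
      then show "?A (w @ [b]) (w @ [b]) = E' (nths w S) (nths w S)" using A diag by metis
    qed
    finally show ?thesis .
  qed
  \<comment> \<open>A diagonal entry depends only on the letters in \<open>S\<close>, which
    \<open>h\<close> preserves although it may change the receiver's letter.\<close>
  have T_const: "T k = T k'" if k: "k \<in> words \<kappa>" "k' \<in> words \<kappa>" for k k'
  proof -
    obtain h where h: "bij_betw h {(w, b). w \<in> X k b} {(w, b). w \<in> X k' b}"
      and hS: "\<And>w b i. w \<in> X k b \<Longrightarrow> i \<in> S \<Longrightarrow> fst (h (w, b)) ! i = w ! i"
      using X_uniform[of S k k'] ES k by blast
    have "T k' = (\<Sum>z\<in>{(w, b). w \<in> X k b}. E' (nths (fst (h z)) S) (nths (fst (h z)) S))"
      unfolding T_pairs[OF k(2)] case_prod_unfold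
      using sum.reindex_bij_betw[OF h, of "\<lambda>z. E' (nths (fst z) S) (nths (fst z) S)"]
      by (simp add: case_prod_unfold)
    also have "\<dots> = T k"
      unfolding T_pairs[OF k(1)]
    proof (intro sum.cong refl, clarsimp)
      fix w b assume w: "w \<in> X k b"
      then have "h (w, b) \<in> {(w, b). w \<in> X k' b}" using bspec[OF bij_betwE[OF h], of "(w, b)"] by simp
      then have "fst (h (w, b)) \<in> X k' (snd (h (w, b)))" by (simp add: case_prod_unfold)
      then have "fst (h (w, b)) \<in> words n" using X_words[OF k(2)] by blast
      moreover have "w \<in> words n" using w X_words[OF k(1)] by auto
      ultimately have "nths (fst (h (w, b))) S = nths w S"
        using hS[OF w] by (subst nths_eq_iff) (auto simp: words_def)
      then show "E' (nths (fst (h (w, b))) S) (nths (fst (h (w, b))) S) = E' (nths w S) (nths w S)"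
        by simp
    qed
    finally show ?thesis by simp
  qed
  obtain k0 :: "'b list" where k0: "k0 \<in> words \<kappa>"
    by (rule that[of "replicate \<kappa> 0"]) (simp add: words_def)
  have "op_comp (n + 1) Proj (op_comp (n + 1) ?A Proj) x z = T k0 / of_nat M * Proj x z" for x z
  proof -
    have "op_comp (n + 1) Proj (op_comp (n + 1) ?A Proj) x z
        = (\<Sum>k\<in>words \<kappa>. \<Sum>k'\<in>words \<kappa>. ind k x * ind k' z * (if k = k' then T k0 else 0)) / (of_nat M)\<^sup>2"
      using Proj_comp[of ?A x z] sumA T_const[OF _ k0] by (auto intro!: sum.cong)
    also have "\<dots> = (\<Sum>k\<in>words \<kappa>. ind k x * ind k z * T k0) / (of_nat M)\<^sup>2"
      by (simp add: if_distrib[where f = "\<lambda>u. _ * u"] cong: if_cong)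
    finally show ?thesis
      by (simp add: Proj_def power2_eq_square sum_distrib_left sum_divide_distrib mult_ac)
  qed
  then show "\<exists>\<mu>. op_comp (n + 1) Proj (op_comp (n + 1) ?A Proj) = (\<lambda>x y. \<mu> * Proj x y)"
    by blast
qed

section \<open>The encoding unitary and its action on the input\<close>

definition emb :: "'b list \<Rightarrow> 'b \<Rightarrow> 'b list" where
  "emb k b = k @ replicate (n - \<kappa> - 1) 0 @ [b]"

lemma emb_words: "k \<in> words \<kappa> \<Longrightarrow> emb k b \<in> words n"
  using \<kappa>_less by (simp add: emb_def words_def)

lemma emb_eq_iff: "k \<in> words \<kappa> \<Longrightarrow> k' \<in> words \<kappa> \<Longrightarrow> emb k b = emb k' b' \<longleftrightarrow> k = k' \<and> b = b'"
  by (auto simp: emb_def words_def)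

text \<open>The input words \<open>emb k b\<close> hold the message, the zero ancillas and the
  sender's letter of the pair. The columns wanted there are normalized indicator vectors of the sets
  \<open>X k b\<close>, orthonormal because these sets are disjoint with \<open>K\<close> elements
  each.\<close>

lemma encoding_unitary:
  "\<exists>U. unitary_op n U \<and> (\<forall>k\<in>words \<kappa>. \<forall>b w. w \<in> words n \<longrightarrow>
     U w (emb k b) = (if w \<in> X k b then complex_of_real (1 / sqrt (real K)) else 0))"
proof -
  let ?J = "(\<lambda>(k, b). emb k b) ` (words \<kappa> \<times> UNIV)"
  \<comment> \<open>\<open>take \<kappa> j\<close> and \<open>last j\<close> recover
    \<open>k\<close> and \<open>b\<close> from \<open>j = emb k b\<close>.\<close>
  define f where "f j w = (if w \<in> X (take \<kappa> j) (last j) then 1 / sqrt (real K) else 0)" for j w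
  have f_emb: "f (emb k b) w = (if w \<in> X k b then 1 / sqrt (real K) else 0)" if "k \<in> words \<kappa>" for k b w
    using that by (simp add: f_def emb_def words_def)
  have orth: "(\<Sum>x\<in>words n. f (emb k b) x * f (emb k' b') x) = (if emb k b = emb k' b' then 1 else 0)"
    if k: "k \<in> words \<kappa>" "k' \<in> words \<kappa>" for k k' b b'
  proof (cases "k = k' \<and> b = b'")
    case True
    have "(\<Sum>x\<in>words n. f (emb k b) x * f (emb k b) x) = (\<Sum>x\<in>X k b. 1 / real K)"
      by (rule sum.mono_neutral_cong_right) (use X_words k in \<open>auto simp: f_emb\<close>)
    then show ?thesis using True k K_pos card_X by simp
  next
    case False
    then have "f (emb k b) x * f (emb k' b') x = 0" for x
      using X_disjoint[OF k] by (auto simp: f_emb k)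
    then have "(\<Sum>x\<in>words n. f (emb k b) x * f (emb k' b') x) = 0" by (intro sum.neutral ballI)
    then show ?thesis using False k by (auto simp: emb_eq_iff)
  qed
  have "\<exists>A. (\<forall>j\<in>?J. \<forall>x\<in>words n. A x j = f j x) \<and>
    (\<forall>j\<in>words n. \<forall>k\<in>words n. (\<Sum>x\<in>words n. A x j * A x k) = (if j = k then 1 else 0)) \<and>
    (\<forall>x\<in>words n. \<forall>y\<in>words n. (\<Sum>j\<in>words n. A x j * A y j) = (if x = y then 1 else 0))"
    using emb_words orth by (intro orthonormal_columns_extend) auto
  then obtain A where A: "\<forall>j\<in>?J. \<forall>x\<in>words n. A x j = f j x"
    and A_col: "\<forall>j\<in>words n. \<forall>k\<in>words n. (\<Sum>x\<in>words n. A x j * A x k) = (if j = k then 1 else 0)"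
    and A_row: "\<forall>x\<in>words n. \<forall>y\<in>words n. (\<Sum>j\<in>words n. A x j * A y j) = (if x = y then 1 else 0)"
    by (elim exE conjE)
  have A_J: "A x (emb k b) = f (emb k b) x" if "k \<in> words \<kappa>" "x \<in> words n" for k b x
    using A that by auto
  define U :: "'b qop" where "U x y = (if x \<in> words n \<and> y \<in> words n then complex_of_real (A x y) else 0)" for x y
  have "op_comp n (op_adjoint U) U x z = op_id n x z" for x z
  proof (cases "x \<in> words n \<and> z \<in> words n")
    case True
    then have "op_comp n (op_adjoint U) U x z = complex_of_real (\<Sum>y\<in>words n. A y x * A y z)"
      by (simp add: op_comp_def op_adjoint_def U_def)
    then show ?thesis using True A_col by (simp add: op_id_def)
  next
    case False
    then show ?thesis by (auto simp: op_comp_def op_adjoint_def U_def op_id_def)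
  qed
  moreover have "op_comp n U (op_adjoint U) x z = op_id n x z" for x z
  proof (cases "x \<in> words n \<and> z \<in> words n")
    case True
    then have "op_comp n U (op_adjoint U) x z = complex_of_real (\<Sum>y\<in>words n. A x y * A z y)"
      by (simp add: op_comp_def op_adjoint_def U_def)
    then show ?thesis using True A_row by (simp add: op_id_def)
  next
    case False
    then show ?thesis by (auto simp: op_comp_def op_adjoint_def U_def op_id_def)
  qed
  moreover have "U \<in> qops n" by (auto simp: qops_def U_def)
  ultimately have "unitary_op n U" by (simp add: unitary_op_def fun_eq_iff)
  moreover have "U w (emb k b) = (if w \<in> X k b then complex_of_real (1 / sqrt (real K)) else 0)"
    if "k \<in> words \<kappa>" "w \<in> words n" for k b w
    using that emb_words by (simp add: U_def A_J f_emb)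
  ultimately show ?thesis by blast
qed

text \<open>The pair ties the sender's last letter to the receiver's letter \<open>b\<close>, and
  the ancillas are zero; so only inputs \<open>emb k b\<close> followed by \<open>b\<close> can have
  a nonzero amplitude.\<close>

lemma encoder_input:
  fixes \<psi> :: "'b qvec"
  assumes "w \<in> words n"
  shows "vec_tensor \<kappa> \<psi> (vec_tensor (n - \<kappa> - 1) (ket (replicate (n - \<kappa> - 1) 0)) (max_entangled_pairs 1)) (w @ [b])
    = (if w = emb (take \<kappa> w) b then \<psi> (take \<kappa> w) / complex_of_real (sqrt (real CARD('b))) else 0)"
proof -
  define m where "m = n - \<kappa> - 1"
  have n: "n = \<kappa> + m + 1" using \<kappa>_less by (simp add: m_def)
  obtain k x b' where w: "w = k @ x @ [b']" and len: "length k = \<kappa>" "length x = m"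
  proof
    show "w = take \<kappa> w @ butlast (drop \<kappa> w) @ [last (drop \<kappa> w)]"
      using assms n by (subst append_butlast_last_id) (auto simp: words_def)
  qed (use assms n in \<open>auto simp: words_def\<close>)
  have emb: "emb (take \<kappa> w) b = k @ replicate m 0 @ [b]"
    using len by (simp add: emb_def m_def w)
  have "max_entangled_pairs 1 [b', b] = (if b' = b then complex_of_real (1 / sqrt (real CARD('b))) else 0)"
    by (simp add: max_entangled_pairs_def words_def max_entangled_pair)
  then show ?thesis
    using len unfolding emb m_def[symmetric] by (simp add: w vec_tensor_def ket_def)
qed

text \<open>Only the prescribed columns of \<open>U\<close> meet nonzero input amplitudes. The
  factor \<open>1 / sqrt K\<close> of these columns and the factor of the pair multiply to the
  normalization by \<open>sqrt M\<close>.\<close>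

lemma encode_eq_state:
  fixes U :: "'b qop"
  assumes U: "\<And>k b w. k \<in> words \<kappa> \<Longrightarrow> w \<in> words n \<Longrightarrow>
      U w (emb k b) = (if w \<in> X k b then complex_of_real (1 / sqrt (real K)) else 0)"
    and Uops: "U \<in> qops n"
  shows "eaqecc_encode n \<kappa> 1 U \<psi> = state \<psi>"
proof
  fix x :: "'b list"
  let ?v = "vec_tensor \<kappa> \<psi> (vec_tensor (n - \<kappa> - 1) (ket (replicate (n - \<kappa> - 1) 0)) (max_entangled_pairs 1))"
  show "eaqecc_encode n \<kappa> 1 U \<psi> x = state \<psi> x"
  proof (cases "x \<in> words (Suc n)")
    case False
    \<comment> \<open>A word of wrong length is too short for \<open>U\<close> or leaves a remainder
      that is not a single letter.\<close>
    have "op_tensor n U (op_id 1) x y = 0" for y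
    proof (cases "length x < n")
      case True
      then show ?thesis using Uops by (auto simp: op_tensor_def qops_def words_def)
    next
      case False
      then have "drop n x \<notin> words 1" using \<open>x \<notin> words (Suc n)\<close> by (auto simp: words_def)
      then show ?thesis by (simp add: op_tensor_def op_id_def)
    qed
    then show ?thesis using False by (simp add: eaqecc_encode_def op_apply_def state_def ind_outside)
  next
    case True
    then obtain w b where x: "x = w @ [b]" and w: "w \<in> words n"
      by (auto simp: words_def length_Suc_conv_rev)
    have "eaqecc_encode n \<kappa> 1 U \<psi> x
        = (\<Sum>w'\<in>words n. \<Sum>b'\<in>UNIV. op_tensor n U (op_id 1) (w @ [b]) (w' @ [b']) * ?v (w' @ [b']))"
      by (simp add: eaqecc_encode_def op_apply_def x sum_words_Suc)
    also have "\<dots> = (\<Sum>w'\<in>words n. \<Sum>b'\<in>UNIV. if b' = b then U w w' * ?v (w' @ [b]) else 0)"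
      by (intro sum.cong refl) (use w in \<open>auto simp: op_tensor_def op_id_def words_def\<close>)
    also have "\<dots> = (\<Sum>w'\<in>words n. U w w' * ?v (w' @ [b]))" by simp
    also have "\<dots> = (\<Sum>w'\<in>(\<lambda>k. emb k b) ` words \<kappa>. U w w' * ?v (w' @ [b]))"
    proof (rule sum.mono_neutral_right)
      show "\<forall>w'\<in>words n - (\<lambda>k. emb k b) ` words \<kappa>. U w w' * ?v (w' @ [b]) = 0"
      proof
        fix w' assume w': "w' \<in> words n - (\<lambda>k. emb k b) ` words \<kappa>"
        have "take \<kappa> w' \<in> words \<kappa>" using w' \<kappa>_less by (auto simp: words_def)
        then have "w' \<noteq> emb (take \<kappa> w') b" using w' by auto
        then show "U w w' * ?v (w' @ [b]) = 0" using w' encoder_input[of w' \<psi> b] by simp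
      qed
    qed (use emb_words in auto)
    also have "\<dots> = (\<Sum>k\<in>words \<kappa>. U w (emb k b) * ?v (emb k b @ [b]))"
      by (subst sum.reindex) (auto simp: inj_on_def emb_eq_iff)
    also have "\<dots> = (\<Sum>k\<in>words \<kappa>. (if w \<in> X k b then complex_of_real (1 / sqrt (real K)) else 0) *
        (\<psi> k / complex_of_real (sqrt (real CARD('b)))))"
    proof (rule sum.cong[OF refl])
      fix k :: "'b list" assume k: "k \<in> words \<kappa>"
      have "take \<kappa> (emb k b) = k" using k by (simp add: emb_def words_def)
      then show "U w (emb k b) * ?v (emb k b @ [b]) = (if w \<in> X k b then complex_of_real (1 / sqrt (real K)) else 0) *
        (\<psi> k / complex_of_real (sqrt (real CARD('b))))"
        using encoder_input[OF emb_words[OF k], of \<psi> b b] U[OF k w] by simp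
    qed
    also have "\<dots> = state \<psi> x"
      unfolding state_def x sum_divide_distrib
      by (intro sum.cong refl) (simp add: ind_def snoc_in_Z M_def real_sqrt_mult)
    finally show ?thesis .
  qed
qed

theorem eaqecc_exists: "\<exists>Q :: 'b qvec set. eaqecc_params n \<kappa> \<delta> 1 Q"
proof -
  obtain U where U: "unitary_op n U" "\<And>k b w. k \<in> words \<kappa> \<Longrightarrow> w \<in> words n \<Longrightarrow>
      U w (emb k b) = (if w \<in> X k b then complex_of_real (1 / sqrt (real K)) else 0)"
    using encoding_unitary by blast
  have "eaqecc_encode n \<kappa> 1 U = state"
    using encode_eq_state[of U] U by (auto simp: unitary_op_def)
  then have "eaqecc n \<kappa> 1 (state ` qvecs \<kappa>)"
    using U(1) \<kappa>_less unfolding eaqecc_def by metis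
  then show ?thesis using min_distance by (auto simp: eaqecc_params_def)
qed

end

section \<open>Entanglement-assisted codes from linear codes\<close>

definition diff_closed :: "'x::ab_group_add set \<Rightarrow> bool" where
  "diff_closed G \<longleftrightarrow> 0 \<in> G \<and> (\<forall>x\<in>G. \<forall>y\<in>G. x - y \<in> G)"

lemma diff_closedD:
  assumes "diff_closed G"
  shows "0 \<in> G" "x \<in> G \<Longrightarrow> y \<in> G \<Longrightarrow> x - y \<in> G" "x \<in> G \<Longrightarrow> y \<in> G \<Longrightarrow> x + y \<in> G"
proof -
  show 0: "0 \<in> G" and diff: "x \<in> G \<Longrightarrow> y \<in> G \<Longrightarrow> x - y \<in> G" for x y
    using assms by (auto simp: diff_closed_def)
  show "x + y \<in> G" if "x \<in> G" "y \<in> G"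
    using diff[OF that(1) diff[OF 0 that(2)]] by simp
qed

lemma card_le_fibres:
  assumes "finite G" "\<And>x. x \<in> G \<Longrightarrow> card {y \<in> G. h y = h x} \<le> K"
  shows "card G \<le> K * card (h ` G)"
proof -
  have "card G = (\<Sum>z\<in>h ` G. card {y \<in> G. h y = z})"
    using sum.image_gen[OF assms(1), of "\<lambda>_. 1::nat" h] by simp
  also have "\<dots> \<le> (\<Sum>z\<in>h ` G. K)" by (rule sum_mono) (use assms(2) in auto)
  finally show ?thesis by (simp add: mult.commute)
qed

text \<open>Each nonempty fibre of a homomorphism is a translate of its kernel.\<close>

lemma card_kernel_image:
  fixes h :: "'x::ab_group_add \<Rightarrow> 'y::ab_group_add"
  assumes "finite G" "diff_closed G" "\<And>x y. x \<in> G \<Longrightarrow> y \<in> G \<Longrightarrow> h (x - y) = h x - h y"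
  shows "card G = card {x \<in> G. h x = 0} * card (h ` G)"
proof -
  have fibre: "card {y \<in> G. h y = h x} = card {x \<in> G. h x = 0}" if x: "x \<in> G" for x
  proof (rule bij_betw_same_card, rule bij_betw_byWitness[where f = "\<lambda>y. y - x" and f' = "\<lambda>y. y + x"])
    show "\<forall>y\<in>{y \<in> G. h y = h x}. y - x + x = y" by simp
    show "\<forall>y\<in>{y \<in> G. h y = 0}. y + x - x = y" by simp
    show "(\<lambda>y. y - x) ` {y \<in> G. h y = h x} \<subseteq> {x \<in> G. h x = 0}"
      using assms x diff_closedD[OF assms(2)] by auto
    have "h (y + x) = h x" if "y \<in> G" "h y = 0" for y
      using assms(3)[of "y + x" x] diff_closedD(3)[OF assms(2) that(1) x] x that by simp
    then show "(\<lambda>y. y + x) ` {x \<in> G. h x = 0} \<subseteq> {y \<in> G. h y = h x}"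
      using x diff_closedD(3)[OF assms(2)] by auto
  qed
  have "card G = (\<Sum>z\<in>h ` G. card {y \<in> G. h y = z})"
    using sum.image_gen[OF assms(1), of "\<lambda>_. 1::nat" h] by simp
  also have "\<dots> = (\<Sum>z\<in>h ` G. card {x \<in> G. h x = 0})"
    by (rule sum.cong[OF refl]) (use fibre in blast)
  finally show ?thesis by simp
qed

section \<open>Vectors with entries in a given subset, and dual codes\<close>

definition vecs :: "nat \<Rightarrow> 'a::zero set \<Rightarrow> (nat \<Rightarrow> 'a) set" where
  "vecs n F = {v. (\<forall>i<n. v i \<in> F) \<and> (\<forall>i\<ge>n. v i = 0)}"

definition dot :: "nat \<Rightarrow> (nat \<Rightarrow> 'a::comm_semiring_0) \<Rightarrow> (nat \<Rightarrow> 'a) \<Rightarrow> 'a" where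
  "dot n v w = (\<Sum>i<n. v i * w i)"

definition dual :: "nat \<Rightarrow> 'a::comm_semiring_0 set \<Rightarrow> (nat \<Rightarrow> 'a) set \<Rightarrow> (nat \<Rightarrow> 'a) set" where
  "dual n F R = {v \<in> vecs n F. \<forall>g\<in>R. dot n v g = 0}"

lemma vecs_eqI: "v \<in> vecs n F \<Longrightarrow> w \<in> vecs n F \<Longrightarrow> (\<And>i. i < n \<Longrightarrow> v i = w i) \<Longrightarrow> v = w"
  by (auto simp: vecs_def fun_eq_iff) (metis not_le)

lemma bij_betw_vecs: "bij_betw (\<lambda>v. map v [0..<n]) (vecs n F) {xs. set xs \<subseteq> F \<and> length xs = n}"
proof (rule bij_betw_byWitness[where f' = "\<lambda>xs i. if i < n then xs ! i else 0"])
  show "\<forall>v\<in>vecs n F. (\<lambda>i. if i < n then map v [0..<n] ! i else 0) = v"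
    by (auto simp: vecs_def fun_eq_iff)
  show "\<forall>xs\<in>{xs. set xs \<subseteq> F \<and> length xs = n}. map (\<lambda>i. if i < n then xs ! i else 0) [0..<n] = xs"
    by (auto intro!: nth_equalityI)
qed (auto simp: vecs_def)

lemma finite_vecs: "finite F \<Longrightarrow> finite (vecs n F)"
  using bij_betw_finite[OF bij_betw_vecs] finite_lists_length_eq by blast

lemma card_vecs: "finite F \<Longrightarrow> card (vecs n F) = card F ^ n"
  using bij_betw_same_card[OF bij_betw_vecs] card_lists_length_eq by metis

lemma diff_closed_vecs: "diff_closed F \<Longrightarrow> diff_closed (vecs n F)"
  by (auto simp: diff_closed_def vecs_def)

lemma dot_diff: "dot n (v - w) g = dot n v g - dot n w (g :: nat \<Rightarrow> 'a::comm_ring)"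
  by (simp add: dot_def left_diff_distrib sum_subtractf)

lemma diff_closed_dual:
  fixes F :: "'a::comm_ring set"
  shows "diff_closed F \<Longrightarrow> diff_closed (dual n F R)"
  using diff_closedD[OF diff_closed_vecs[of F n]]
  unfolding diff_closed_def[of "dual n F R"] by (auto simp: dual_def dot_diff) (simp add: dot_def)

text \<open>The alphabet \<open>'b\<close> is only a set of labels: any bijection between it and \<open>F\<close> will do, whatever
  the field structure of \<open>'b\<close>.\<close>

lemma eaqecc_from_code:
  fixes F :: "'a::field set" and R :: "(nat \<Rightarrow> 'a) set"
  assumes card_F: "card F = CARD('b::{finite,zero})" and F: "diff_closed F" "1 \<in> F"
    and R: "R \<subseteq> vecs n F" "diff_closed R"
    and l: "l < n" and form: "\<And>x y. x \<in> R \<Longrightarrow> y \<in> R \<Longrightarrow> dot n x y = x l * y l"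
    and onto: "\<And>S w. S \<subseteq> {..<n} \<Longrightarrow> card S < \<delta> \<Longrightarrow> w \<in> vecs n F \<Longrightarrow> \<exists>g\<in>R. \<forall>i\<in>S. g i = w i"
    and \<delta>: "1 < \<delta>"
    and card_R: "card R \<le> CARD('b) ^ m" and card_dual: "CARD('b) ^ (n - m) \<le> card (dual n F R)"
    and m: "1 \<le> m" "m \<le> n" "2 * m \<le> n + 1"
  shows "\<exists>Q :: 'b qvec set. eaqecc_params n (n + 1 - 2 * m) \<delta> 1 Q"
proof -
  define q \<kappa> V C where "q = CARD('b)" and "\<kappa> = n + 1 - 2 * m" and "V = vecs n F" and "C = dual n F R"
  have fin_F: "finite F" using card_F by (metis card.infinite finite_UNIV_card_ge_0 finite less_irrefl)
  have V: "diff_closed V" and fin_V: "finite V"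
    unfolding V_def using F fin_F by (auto intro: diff_closed_vecs finite_vecs)
  have C: "C \<subseteq> V" "diff_closed C"
    unfolding V_def C_def using diff_closed_dual[OF F(1)] by (auto simp: dual_def)
  have RV: "R \<subseteq> V" using R by (simp add: V_def)
  have fin_R: "finite R" and fin_C: "finite C" using RV C fin_V finite_subset by auto
  define R0 where "R0 = {x \<in> R. x l = 0}"
  have R0: "R0 \<subseteq> R" "diff_closed R0"
    using R(2) by (auto simp: R0_def diff_closed_def)
  have fin_R0: "finite R0" using R0 fin_R finite_subset by blast
  \<comment> \<open>By \<open>form\<close>, words of \<open>R\<close> vanishing at \<open>l\<close>
    are orthogonal to all of \<open>R\<close>.\<close>
  have R0_C: "R0 \<subseteq> C"
    using form R by (auto simp: R0_def C_def dual_def)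
  have unit: "(\<lambda>j. if j = i then c else 0) \<in> V" if "i < n" "c \<in> F" for i c
    using that diff_closedD(1)[OF F(1)] by (auto simp: V_def vecs_def)
  have level: "\<exists>g\<in>R. g l = c" if "c \<in> F" for c
    using onto[of "{l}" "\<lambda>j. if j = l then c else 0"] unit[OF l that] l \<delta> by (simp add: V_def)
  obtain r where r: "r \<in> R" "r l = 1" using level F by blast

  \<comment> \<open>Evaluation at \<open>l\<close> maps \<open>R\<close> onto \<open>F\<close> with
    kernel \<open>R0\<close>, so \<open>R0\<close> is smaller than \<open>R\<close> by the factor
    \<open>q\<close>.\<close>
  have "card R = card R0 * card ((\<lambda>x. x l) ` R)"
    using card_kernel_image[OF fin_R R(2), of "\<lambda>x. x l"] by (simp add: R0_def)
  also have "(\<lambda>x. x l) ` R = F" using level R l by (force simp: vecs_def)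
  finally have "card R0 * q \<le> q ^ m" using card_R card_F by (simp add: q_def)
  then have "card R0 * q \<le> q ^ (m - 1) * q" using m by (simp flip: power_Suc2)
  then have card_R0: "card R0 \<le> q ^ (m - 1)" by (simp add: q_def)

  define coset where "coset c = (\<lambda>x. c + x) ` R0" for c :: "nat \<Rightarrow> 'a"
  have coset_eq: "coset c = coset c'" if "c - c' \<in> R0" for c c'
  proof -
    have "coset c \<subseteq> coset c'" if d: "c - c' \<in> R0" for c c'
    proof
      fix x assume "x \<in> coset c"
      then obtain y where y: "y \<in> R0" "x = c + y" by (auto simp: coset_def)
      then have "x = c' + ((c - c') + y)" by simp
      then show "x \<in> coset c'"
        unfolding coset_def using diff_closedD(3)[OF R0(2) d y(1)] by (rule image_eqI)
    qed
    moreover have "c' - c \<in> R0" using diff_closedD(2)[OF R0(2) diff_closedD(1)[OF R0(2)] that] by simp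
    ultimately show ?thesis using that by blast
  qed
  \<comment> \<open>At most \<open>card R0\<close> words of \<open>C\<close> share a coset, so there
    are at least \<open>q ^ (n - m) / q ^ (m - 1) = q ^ \<kappa>\<close> cosets, enough for all
    messages.\<close>
  have "card C \<le> card R0 * card (coset ` C)"
  proof (rule card_le_fibres[OF fin_C])
    fix x assume "x \<in> C"
    have "y \<in> coset y" for y using diff_closedD(1)[OF R0(2)] by (force simp: coset_def)
    then have "{y \<in> C. coset y = coset x} \<subseteq> coset x" by auto
    then have "card {y \<in> C. coset y = coset x} \<le> card (coset x)"
      by (rule card_mono[rotated]) (simp add: coset_def fin_R0)
    also have "\<dots> \<le> card R0" by (simp add: coset_def card_image_le fin_R0)
    finally show "card {y \<in> C. coset y = coset x} \<le> card R0" .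
  qed
  also have "\<dots> \<le> q ^ (m - 1) * card (coset ` C)" using card_R0 by simp
  finally have "q ^ (n - m) \<le> q ^ (m - 1) * card (coset ` C)"
    using card_dual by (simp add: C_def q_def)
  moreover have "n - m = (m - 1) + \<kappa>" using m by (simp add: \<kappa>_def)
  ultimately have "q ^ (m - 1) * q ^ \<kappa> \<le> q ^ (m - 1) * card (coset ` C)" by (simp add: power_add)
  then have "q ^ \<kappa> \<le> card (coset ` C)" by (simp add: q_def)
  moreover have "card (words \<kappa> :: 'b list set) = q ^ \<kappa>"
    using card_lists_length_eq[of "UNIV :: 'b set" \<kappa>] by (simp add: words_def q_def)
  ultimately obtain f :: "'b list \<Rightarrow> _" where f: "f ` words \<kappa> \<subseteq> coset ` C" "inj_on f (words \<kappa>)"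
    using card_le_inj[of "words \<kappa> :: 'b list set" "coset ` C"] fin_C by auto
  have "\<forall>k\<in>words \<kappa>. \<exists>c\<in>C. coset c = f k" using f(1) by (metis image_iff image_subset_iff)
  then obtain u :: "'b list \<Rightarrow> _" where u: "\<And>k. k \<in> words \<kappa> \<Longrightarrow> u k \<in> C" "\<And>k. k \<in> words \<kappa> \<Longrightarrow> coset (u k) = f k"
    by metis
  have u_inj: "k = k'" if "k \<in> words \<kappa>" "k' \<in> words \<kappa>" "u k - u k' \<in> R0" for k k'
    using coset_eq[OF that(3)] u(2) f(2) that by (metis inj_onD)

  obtain \<beta> :: "'b \<Rightarrow> 'a" where \<beta>: "bij_betw \<beta> UNIV F"
    using card_F fin_F finite_same_card_bij[of "UNIV :: 'b set" F] by auto
  have \<beta>_inv: "\<beta> (inv \<beta> c) = c" if "c \<in> F" for c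
    using \<beta> that by (simp add: bij_betw_def f_inv_into_f)
  have \<beta>_inv': "inv \<beta> (\<beta> b) = b" for b
    using \<beta> by (simp add: bij_betw_def inv_f_f)
  have \<beta>_F: "\<beta> b \<in> F" for b using \<beta> by (auto simp: bij_betw_def)
  define enc where "enc v = map (\<lambda>i. inv \<beta> (v i)) [0..<n]" for v :: "nat \<Rightarrow> 'a"
  have enc_nth: "\<beta> (enc v ! i) = v i" if "v \<in> V" "i < n" for v i
    using that \<beta>_inv by (simp add: enc_def V_def vecs_def)
  have enc_eq: "enc v ! i = enc w ! i \<longleftrightarrow> v i = w i" if "v \<in> V" "w \<in> V" "i < n" for v w i
    using enc_nth[OF that(1,3)] enc_nth[OF that(2,3)] that by (metis (lifting) enc_def add_0 nth_map_upt diff_zero)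
  have enc_inj: "v = w" if "v \<in> V" "w \<in> V" "enc v = enc w" for v w
  proof (rule vecs_eqI)
    show "v \<in> vecs n F" "w \<in> vecs n F" using that by (simp_all add: V_def)
    show "v i = w i" if "i < n" for i
      using enc_eq[OF \<open>v \<in> V\<close> \<open>w \<in> V\<close> that] \<open>enc v = enc w\<close> by simp
  qed
  \<comment> \<open>The message selects the translate \<open>u k\<close>, and the receiver's letter
    records the value of \<open>g\<close> at \<open>l\<close>.\<close>
  define X where "X k b = (\<lambda>g. enc (u k + g)) ` {g \<in> R. g l = \<beta> b}" for k b
  have uR: "u k + g \<in> V" if "k \<in> words \<kappa>" "g \<in> R" for k g
    using diff_closedD(3)[OF V] u(1)[OF that(1)] that C(1) RV by blast
  have uR_inj: "k = k' \<and> g = g'"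
    if k: "k \<in> words \<kappa>" "k' \<in> words \<kappa>" and g: "g \<in> R" "g' \<in> R" and eq: "u k + g = u k' + g'" for k k' g g'
  proof -
    \<comment> \<open>The difference is in \<open>C\<close> and, by this equation, in
      \<open>R\<close>. Being orthogonal to \<open>r\<close>, it vanishes at \<open>l\<close> by
      \<open>form\<close>, hence belongs to \<open>R0\<close>.\<close>
    have d: "u k - u k' = g' - g" using eq by (simp add: algebra_simps)
    have "u k - u k' \<in> C" using u(1) k diff_closedD(2)[OF C(2)] by blast
    then have "dot n (u k - u k') r = 0" using r by (simp add: C_def dual_def)
    moreover have "g' - g \<in> R" using g diff_closedD(2)[OF R(2)] by blast
    ultimately have "(g' - g) l = 0" using form[of "g' - g" r] r d by simp
    then have "u k - u k' \<in> R0" using \<open>g' - g \<in> R\<close> d by (simp add: R0_def)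
    then have "k = k'" using u_inj k by blast
    then show ?thesis using eq by simp
  qed
  interpret coset_family n \<kappa> "card R0" \<delta> X
  proof
    show "\<kappa> + 1 \<le> n" using m by (simp add: \<kappa>_def)
    show "card R0 > 0" using fin_R0 diff_closedD(1)[OF R0(2)] by (auto simp: card_gt_0_iff)
    show "X k b \<subseteq> words n" for k b by (auto simp: X_def enc_def words_def)
  next
    fix k :: "'b list" and b assume k: "k \<in> words \<kappa>"
    obtain g0 where g0: "g0 \<in> R" "g0 l = \<beta> b" using level \<beta>_F by blast
    have "bij_betw (\<lambda>x. g0 + x) R0 {g \<in> R. g l = \<beta> b}"
      by (rule bij_betw_byWitness[where f' = "\<lambda>g. g - g0"])
        (use g0 R0 diff_closedD[OF R(2)] in \<open>auto simp: R0_def\<close>)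
    moreover have "inj_on (\<lambda>g. enc (u k + g)) {g \<in> R. g l = \<beta> b}"
    proof (rule inj_onI)
      fix g g' assume "g \<in> {g \<in> R. g l = \<beta> b}" "g' \<in> {g \<in> R. g l = \<beta> b}" "enc (u k + g) = enc (u k + g')"
      then show "g = g'" using enc_inj[OF uR[OF k] uR[OF k], of g g'] by simp
    qed
    ultimately show "card (X k b) = card R0"
      unfolding X_def by (metis (lifting) bij_betw_same_card card_image)
  next
    fix k k' :: "'b list" and w b b'
    assume k: "k \<in> words \<kappa>" "k' \<in> words \<kappa>" and w: "w \<in> X k b" "w \<in> X k' b'"
    then obtain g g' where g: "g \<in> R" "g' \<in> R" "g l = \<beta> b" "g' l = \<beta> b'" "enc (u k + g) = enc (u k' + g')"
      by (auto simp: X_def)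
    then have "u k + g = u k' + g'" using enc_inj[OF uR[OF k(1)] uR[OF k(2)]] by blast
    then have "k = k' \<and> g = g'" using uR_inj[OF k g(1,2)] by blast
    then show "k = k' \<and> b = b'" using g \<beta>_inv' by metis
  next
    fix S and k k' w w' :: "'b list" and b
    assume S: "S \<subseteq> {..<n}" "card S < \<delta>" and k: "k \<in> words \<kappa>" "k' \<in> words \<kappa>"
      and w: "w \<in> X k b" "w' \<in> X k' b" and agree: "\<And>i. i < n \<Longrightarrow> i \<notin> S \<Longrightarrow> w ! i = w' ! i"
    obtain g g' where g: "g \<in> R" "g' \<in> R" "g l = \<beta> b" "g' l = \<beta> b" "w = enc (u k + g)" "w' = enc (u k' + g')"
      using w by (auto simp: X_def)
    \<comment> \<open>The equal values at \<open>l\<close> put \<open>g - g'\<close> into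
      \<open>R0\<close>, so the difference of the two words is in the dual \<open>C\<close>.\<close>
    define v where "v = (u k - u k') + (g - g')"
    have v_eq: "v i = (u k + g) i - (u k' + g') i" for i by (simp add: v_def)
    have "g - g' \<in> R0" using g diff_closedD(2)[OF R(2)] by (simp add: R0_def)
    then have "v \<in> C"
      unfolding v_def using u(1) k R0_C diff_closedD[OF C(2)] by blast
    have "v i = 0" if i: "i < n" for i
    proof (cases "i \<in> S")
      case True
      \<comment> \<open>On \<open>S\<close> this word of \<open>R\<close> is the unit vector at
        \<open>i\<close>, and off \<open>S\<close> the vector \<open>v\<close> vanishes; so the
        inner product isolates \<open>v i\<close>.\<close>
      obtain h where h: "h \<in> R" "\<forall>j\<in>S. h j = (if j = i then 1 else 0)"
        using onto[OF S] unit[OF i F(2)] by (auto simp: V_def)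
      have "v j * h j = (if j = i then v i else 0)" if "j < n" for j
      proof (cases "j \<in> S")
        case True
        then show ?thesis using h by simp
      next
        case False
        then show ?thesis using agree[OF \<open>j < n\<close>] enc_eq uR k g \<open>j < n\<close> \<open>i \<in> S\<close> by (auto simp: v_eq)
      qed
      then have "dot n v h = (\<Sum>j<n. if j = i then v i else 0)"
        unfolding dot_def by (intro sum.cong) auto
      then have "dot n v h = v i" using i by simp
      then show ?thesis using \<open>v \<in> C\<close> h(1) by (simp add: C_def dual_def)
    next
      case False
      then show ?thesis using agree[OF i] enc_eq uR k g i by (simp add: v_eq)
    qed
    then show "w = w'"
      unfolding g(5,6) by (simp add: enc_def v_eq)
  next
    fix S and k k' :: "'b list"
    assume S: "S \<subseteq> {..<n}" "card S < \<delta>" and k: "k \<in> words \<kappa>" "k' \<in> words \<kappa>"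
    let ?p = "\<lambda>k g. (enc (u k + g), inv \<beta> (g l))"
    have p: "bij_betw (?p k) R {(w, b). w \<in> X k b}" if k: "k \<in> words \<kappa>" for k
      unfolding bij_betw_def
    proof
      show "inj_on (?p k) R"
      proof (rule inj_onI)
        fix g g' assume "g \<in> R" "g' \<in> R" "?p k g = ?p k g'"
        then show "g = g'" using enc_inj[OF uR[OF k] uR[OF k], of g g'] by simp
      qed
      have "g l \<in> F" if "g \<in> R" for g using that R l by (auto simp: vecs_def)
      then show "?p k ` R = {(w, b). w \<in> X k b}"
        by (auto simp: X_def \<beta>_inv \<beta>_inv' image_iff)
    qed
    \<comment> \<open>Translation by a word \<open>g0\<close> of \<open>R\<close> that agrees with
      \<open>u k - u k'\<close> on \<open>S\<close> carries the family of \<open>k\<close> to that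
      of \<open>k'\<close> without changing the letters in \<open>S\<close>.\<close>
    have "u k - u k' \<in> vecs n F"
      unfolding V_def[symmetric] using u(1) k C(1) diff_closedD(2)[OF V] by blast
    then obtain g0 where g0: "g0 \<in> R" "\<forall>i\<in>S. g0 i = (u k - u k') i" using onto[OF S] by blast
    have tr: "bij_betw (\<lambda>g. g + g0) R R"
      by (rule bij_betw_byWitness[where f' = "\<lambda>g. g - g0"]) (use g0 diff_closedD[OF R(2)] in auto)
    define h where "h = ?p k' \<circ> (\<lambda>g. g + g0) \<circ> inv_into R (?p k)"
    have "bij_betw h {(w, b). w \<in> X k b} {(w, b). w \<in> X k' b}"
      unfolding h_def
      by (rule bij_betw_trans[OF bij_betw_inv_into[OF p[OF k(1)]] bij_betw_trans[OF tr p[OF k(2)]]])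
    moreover have "fst (h (w, b)) ! i = w ! i" if w: "w \<in> X k b" and i: "i \<in> S" for w b i
    proof -
      obtain g where g: "g \<in> R" "w = enc (u k + g)" "g l = \<beta> b" using w by (auto simp: X_def)
      then have wb: "(w, b) = ?p k g" by (simp add: \<beta>_inv')
      have "inv_into R (?p k) (w, b) = g"
        unfolding wb by (rule inv_into_f_f[OF bij_betw_imp_inj_on[OF p[OF k(1)]] g(1)])
      then have "fst (h (w, b)) = enc (u k' + (g + g0))" by (simp add: h_def)
      moreover have "(u k' + (g + g0)) i = (u k + g) i" using g0 i by simp
      moreover have "g + g0 \<in> R" using g(1) g0(1) diff_closedD(3)[OF R(2)] by blast
      moreover have "i < n" using i S by auto
      ultimately show ?thesis using enc_eq[OF uR[OF k(2)] uR[OF k(1) g(1)]] g(2) by metis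
    qed
    ultimately show "\<exists>h. bij_betw h {(w, b). w \<in> X k b} {(w, b). w \<in> X k' b} \<and>
            (\<forall>w b. w \<in> X k b \<longrightarrow> (\<forall>i\<in>S. fst (h (w, b)) ! i = w ! i))"
      by blast
  qed
  show ?thesis using eaqecc_exists by (simp add: \<kappa>_def)
qed

section \<open>Finite fields and the trace\<close>

text \<open>Translation by one permutes the elements, so it leaves their sum unchanged.\<close>

lemma of_nat_CARD_eq_0: "of_nat CARD('a) = (0 :: 'a::{ring_1,finite})"
proof -
  have "(\<Sum>x\<in>UNIV. x + 1 :: 'a) = (\<Sum>x\<in>UNIV. x)"
    by (rule sum.reindex_bij_witness[of _ "\<lambda>x. x - 1" "\<lambda>x. x + 1"]) auto
  then show ?thesis by (simp add: sum.distrib)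
qed

lemma CHAR_eq_prime:
  assumes "prime p" "CARD('a::{field,finite}) = p ^ k"
  shows "CHAR('a) = p"
proof -
  have "CHAR('a) dvd p ^ k"
    using of_nat_CARD_eq_0[where 'a = 'a] assms(2) by (simp add: of_nat_eq_0_iff_char_dvd flip: of_nat_power)
  moreover have "CHAR('a) > 0"
    using finite_imp_CHAR_pos[where 'a = 'a] by simp
  then have "prime CHAR('a)" by (rule prime_CHAR_semidom)
  ultimately show ?thesis
    using assms(1) prime_dvd_power primes_dvd_imp_eq by metis
qed

text \<open>Multiplication by a nonzero \<open>x\<close> permutes the nonzero elements, so their
  product absorbs a factor \<open>x ^ (CARD('a) - 1)\<close>.\<close>

lemma power_CARD: "x ^ CARD('a) = (x :: 'a::{field,finite})"
proof (cases "x = 0")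
  case True
  then show ?thesis by (simp add: zero_less_card_finite)
next
  case False
  have "(\<Prod>y\<in>UNIV - {0}. x * y) = (\<Prod>y\<in>UNIV - {0}. y)"
    by (rule prod.reindex_bij_witness[of _ "\<lambda>y. y / x" "\<lambda>y. x * y"]) (use False in auto)
  then have "x ^ (CARD('a) - 1) = 1" by (simp add: prod.distrib card_Diff_singleton)
  moreover have "x ^ (CARD('a) - 1) * x = x ^ CARD('a)"
    by (rule power_minus_mult) simp
  ultimately show ?thesis by simp
qed

text \<open>The polynomial \<open>X ^ (d * e) - 1\<close> is \<open>P * G\<close>, where
  \<open>G\<close> has degree at most \<open>d * (e - 1)\<close>. All \<open>d * e\<close> nonzero
  elements are roots of one of the factors, which leaves at least \<open>d\<close> roots to
  \<open>P\<close>.\<close>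

lemma card_roots_of_unity:
  assumes "d dvd CARD('a::{field,finite}) - 1"
  shows "card {x :: 'a. x ^ d = 1} = d"
proof -
  obtain e where e: "CARD('a) - 1 = d * e" using assms by auto
  have "CARD('a) \<ge> 2"
    using card_mono[of "UNIV :: 'a set" "{0, 1}"] by simp
  then have d: "d > 0" "e > 0" using e by (auto intro!: Nat.gr0I)
  define P G :: "'a poly" where "P = monom 1 d - 1" and "G = (\<Sum>i<e. monom 1 (d * i))"
  have "coeff P d = 1" using d by (simp add: P_def)
  then have "P \<noteq> 0" by auto
  moreover have "degree P \<le> d" unfolding P_def by (intro degree_diff_le) (simp_all add: degree_monom_le)
  ultimately have P: "card {x. poly P x = 0} \<le> d" using card_poly_roots_bound[of P] by simp
  have "poly G 0 = (\<Sum>i<e. if i = 0 then 1 else 0)"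
    unfolding G_def poly_sum poly_monom using d by (intro sum.cong) (auto simp: power_0_left)
  then have "poly G 0 = 1" using d by simp
  then have "G \<noteq> 0" by auto
  moreover have "degree G \<le> d * (e - 1)"
    unfolding G_def
  proof (rule degree_sum_le)
    fix i assume "i \<in> {..<e}"
    then have "d * i \<le> d * (e - 1)" by (intro mult_le_mono2) auto
    then show "degree (monom (1 :: 'a) (d * i)) \<le> d * (e - 1)"
      using degree_monom_le order_trans by blast
  qed simp
  ultimately have G: "card {x. poly G x = 0} \<le> d * (e - 1)" using card_poly_roots_bound[of G] by simp
  have "poly P x = 0 \<or> poly G x = 0" if "x \<noteq> 0" for x
  proof -
    have "x ^ (CARD('a) - 1) * x = x ^ CARD('a)" by (rule power_minus_mult) simp
    then have "x ^ (CARD('a) - 1) = 1" using that power_CARD[of x] by simp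
    then have "(x ^ d) ^ e = 1" unfolding e power_mult .
    then have "(x ^ d) ^ e - 1 = 0" by simp
    then have "(x ^ d - 1) * (\<Sum>i<e. (x ^ d) ^ i) = 0" by (simp add: power_diff_1_eq)
    then show ?thesis by (simp add: P_def G_def poly_monom poly_sum power_mult)
  qed
  then have "UNIV - {0} \<subseteq> {x. poly P x = 0} \<union> {x. poly G x = 0}" by auto
  then have "card (UNIV - {0 :: 'a}) \<le> card ({x. poly P x = 0} \<union> {x. poly G x = 0})"
    by (intro card_mono) auto
  also have "\<dots> \<le> card {x. poly P x = 0} + card {x. poly G x = 0}" by (rule card_Un_le)
  finally have "d * e \<le> card {x. poly P x = 0} + d * (e - 1)"
    using G e by (simp add: card_Diff_singleton)
  then have "d \<le> card {x. poly P x = 0}" using d by (cases e) auto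
  with P show ?thesis by (simp add: P_def poly_monom)
qed

lemma card_eval_points:
  assumes "N > 1" "N - 1 dvd CARD('a::{field,finite}) - 1"
  shows "card (eval_points N :: 'a set) = N"
proof -
  have "eval_points N = insert 0 {x :: 'a. x ^ (N - 1) = 1}"
  proof -
    have "x ^ N = x \<longleftrightarrow> x = 0 \<or> x ^ (N - 1) = 1" for x :: 'a
      using assms(1) power_eq_if[of x N] by auto
    then show ?thesis by (auto simp: eval_points_def)
  qed
  moreover have "0 \<notin> {x :: 'a. x ^ (N - 1) = 1}" using assms(1) by (simp add: power_0_left)
  ultimately show ?thesis using card_roots_of_unity[OF assms(2)] assms(1) by simp
qed

lemma card_power_fixed_le:
  assumes "m > 1"
  shows "card {x :: 'a::{field,finite}. x ^ m = x} \<le> m"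
proof -
  define P :: "'a poly" where "P = monom 1 m - monom 1 1"
  have "coeff P m = 1" using assms by (simp add: P_def)
  then have "P \<noteq> 0" by auto
  moreover have "degree P \<le> m"
    unfolding P_def using assms by (intro degree_diff_le) (auto intro: order_trans[OF degree_monom_le])
  ultimately have "card {x. poly P x = 0} \<le> m" using card_poly_roots_bound[of P] by simp
  then show ?thesis by (simp add: P_def poly_monom)
qed

section \<open>Polynomial interpolation\<close>

lemma interpolation_poly:
  fixes f :: "'a::field \<Rightarrow> 'a"
  assumes "finite A"
  shows "\<exists>p. (\<forall>x\<in>A. poly p x = f x) \<and> (\<forall>e\<ge>card A. coeff p e = 0)"
  using assms
proof (induction A)
  case empty
  show ?case by (rule exI[of _ 0]) simp
next
  case (insert a A)
  then obtain p where p: "\<forall>x\<in>A. poly p x = f x" "\<forall>e\<ge>card A. coeff p e = 0" by blast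
  \<comment> \<open>Newton's correction: this product vanishes at the old nodes, so adding a
    multiple of it adjusts the value at \<open>a\<close> and keeps the others.\<close>
  define m where "m = (\<Prod>x\<in>A. [:- x, 1:])"
  have m: "poly m x = (\<Prod>y\<in>A. x - y)" for x by (simp add: m_def poly_prod)
  have "degree m \<le> card A"
    unfolding m_def by (rule order_trans[OF degree_prod_sum_le]) (use insert.hyps in auto)
  then have deg: "coeff m e = 0" if "e > card A" for e using that by (intro coeff_eq_0) simp
  have ma: "poly m a \<noteq> 0" using insert.hyps by (auto simp: m)
  define c where "c = (f a - poly p a) / poly m a"
  show ?case
  proof (intro exI[of _ "p + smult c m"] conjI ballI allI impI)
    fix x assume "x \<in> insert a A"
    then show "poly (p + smult c m) x = f x"
    proof
      assume "x = a"
      then show ?thesis using ma by (simp add: c_def)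
    next
      assume x: "x \<in> A"
      then have "poly m x = 0" unfolding m using insert.hyps by (auto intro!: prod_zero)
      then show ?thesis using x p by simp
    qed
  next
    fix e assume "card (insert a A) \<le> e"
    then show "coeff (p + smult c m) e = 0" using insert.hyps p(2) deg by simp
  qed
qed

text \<open>A bound on the number of coefficients, rather than on a degree, covers
  \<open>d = 0\<close>, which occurs when \<open>a t = 0\<close>.\<close>

lemma interpolation:
  fixes f :: "'a::field \<Rightarrow> 'a"
  assumes "finite A" "card A \<le> d"
  shows "\<exists>g. \<forall>x\<in>A. (\<Sum>e<d. g e * x ^ e) = f x"
proof -
  obtain p where p: "\<forall>x\<in>A. poly p x = f x" "\<forall>e\<ge>card A. coeff p e = 0"
    using interpolation_poly[OF assms(1)] by blast
  have "poly p x = (\<Sum>e<d. coeff p e * x ^ e)" for x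
  proof -
    have "poly p x = (\<Sum>e\<le>max d (degree p). coeff p e * x ^ e)"
      unfolding poly_altdef by (rule sum.mono_neutral_left) (auto simp: coeff_eq_0)
    also have "\<dots> = (\<Sum>e<d. coeff p e * x ^ e)"
      by (rule sum.mono_neutral_right) (use p(2) assms(2) in auto)
    finally show ?thesis .
  qed
  then show ?thesis using p(1) by metis
qed

lemma sum_cyclic_shift:
  fixes g :: "nat \<Rightarrow> 'a::ab_group_add"
  assumes "g k = g 0"
  shows "(\<Sum>u<k. g (Suc u)) = (\<Sum>u<k. g u)"
proof -
  have "g 0 + (\<Sum>u<k. g (Suc u)) = (\<Sum>u<k. g u) + g k"
    using sum.lessThan_Suc_shift[of g k] sum.lessThan_Suc[of g k] by simp
  then show ?thesis using assms by (simp add: add.commute)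
qed

text \<open>The orbit is a cycle whose size is the least positive period, and the least period
  divides the period \<open>s\<close>.\<close>

lemma funpow_orbit:
  assumes "s > 0" "(f ^^ s) z = z"
  defines "n \<equiv> card (range (\<lambda>i. (f ^^ i) z))"
  shows "n > 0" "n dvd s" "(f ^^ n) z = z"
proof -
  define d where "d = (LEAST d. 0 < d \<and> (f ^^ d) z = z)"
  have d: "0 < d \<and> (f ^^ d) z = z"
    unfolding d_def by (rule LeastI[of _ s]) (use assms in simp)
  have least: "(f ^^ m) z \<noteq> z" if "0 < m" "m < d" for m
    using not_less_Least[of m "\<lambda>d. 0 < d \<and> (f ^^ d) z = z"] that by (auto simp: d_def)
  have "range (\<lambda>i. (f ^^ i) z) = (\<lambda>i. (f ^^ i) z) ` {0..<d}"
  proof (intro equalityI subsetI)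
    fix x assume "x \<in> range (\<lambda>i. (f ^^ i) z)"
    then obtain i where "x = (f ^^ i) z" by blast
    then have "x = (f ^^ (i mod d)) z" using d by (simp add: funpow_mod_eq)
    then show "x \<in> (\<lambda>i. (f ^^ i) z) ` {0..<d}" using d by auto
  qed auto
  then have n: "n = d"
    using inj_on_funpow_least[of d f z] d least by (simp add: n_def card_image)
  have "(f ^^ (s mod d)) z = z" using assms d by (simp add: funpow_mod_eq)
  then have "s mod d = 0" using least[of "s mod d"] d by (metis mod_less_divisor not_gr_zero)
  then show "n > 0" "n dvd s" "(f ^^ n) z = z" using d n by auto
qed

section \<open>The subfield of order \<open>q\<close> and the trace onto it\<close>

locale finite_extension =
  fixes p r q s :: nat and ty :: "'a::{field,finite} itself"
  assumes prime_p: "prime p" and r: "r \<ge> 1" and q_def: "q = p ^ r" and s: "s \<ge> 1"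
    and CARD_a: "CARD('a) = q ^ s"
begin

definition F :: "'a set" where "F = {x. x ^ q = x}"

definition Tr :: "'a \<Rightarrow> 'a" where "Tr x = (\<Sum>l<s. x ^ (q ^ l))"

lemma q_gt_1: "q > 1"
  using one_less_power[of p r] prime_gt_1_nat[OF prime_p] r by (simp add: q_def)

lemma CHAR_a: "CHAR('a) = p"
  by (rule CHAR_eq_prime[OF prime_p, of "r * s"]) (simp add: CARD_a q_def power_mult)

lemma frob_sum: "(sum f A :: 'a) ^ (q ^ l) = (\<Sum>i\<in>A. f i ^ (q ^ l))"
  by (rule freshmans_dream_sum'[of _ "r * l"]) (simp_all add: CHAR_a prime_p q_def power_mult)

lemma frob_add: "(x + y :: 'a) ^ (q ^ l) = x ^ (q ^ l) + y ^ (q ^ l)"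
  by (rule freshmans_dream'[of _ "r * l"]) (simp_all add: CHAR_a prime_p q_def power_mult)

lemma frob_diff: "(x - y :: 'a) ^ (q ^ l) = x ^ (q ^ l) - y ^ (q ^ l)"
  using frob_add[of "x - y" y l] by (simp add: algebra_simps)

lemma power_qs: "(x :: 'a) ^ (q ^ (s * k)) = x"
proof (induction k)
  case (Suc k)
  have "x ^ (q ^ (s * Suc k)) = (x ^ (q ^ (s * k))) ^ (q ^ s)"
    by (simp add: power_add mult.commute flip: power_mult)
  then show ?case using Suc power_CARD[of x] by (simp add: CARD_a)
qed simp

text \<open>The power \<open>q ^ (s * l)\<close> acts as the identity, so the power
  \<open>q ^ (s * l - l)\<close> inverts the given one.\<close>

lemma frob_surj: "\<exists>y :: 'a. y ^ (q ^ l) = x"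
proof
  have "l \<le> s * l" using s by simp
  then have "q ^ (s * l - l) * q ^ l = q ^ (s * l)" by (simp flip: power_add)
  then show "(x ^ (q ^ (s * l - l))) ^ (q ^ l) = x" by (simp add: power_qs flip: power_mult)
qed

lemma F_power: "x \<in> F \<Longrightarrow> x ^ (q ^ l) = x"
  by (induction l) (simp_all add: F_def power_mult)

text \<open>\<open>F\<close> is the set of evaluation points for \<open>N = q\<close>, and
  \<open>q - 1\<close> divides \<open>q ^ s - 1\<close>.\<close>

lemma card_F: "card F = q"
proof -
  have "q - 1 dvd q ^ k - 1" for k
  proof (induction k)
    case (Suc k)
    have "q ^ Suc k - 1 = q * (q ^ k - 1) + (q - 1)"
      using q_gt_1 by (simp add: diff_mult_distrib2)
    then show ?case using Suc by simp
  qed simp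
  then show ?thesis
    using card_eval_points[of q, where 'a = 'a] q_gt_1 by (simp add: CARD_a F_def eval_points_def)
qed

lemma F_closed: "diff_closed F" "1 \<in> F" "x \<in> F \<Longrightarrow> inverse x \<in> F"
  using frob_diff[of _ _ 1] q_gt_1 by (auto simp: F_def diff_closed_def power_mult_distrib power_inverse)

lemma Tr_sum: "Tr (sum f A) = (\<Sum>i\<in>A. Tr (f i))"
  unfolding Tr_def frob_sum by (rule sum.swap)

lemma Tr_add: "Tr (x + y) = Tr x + Tr y"
  by (simp add: Tr_def frob_add sum.distrib)

lemma Tr_diff: "Tr (x - y) = Tr x - Tr y"
  by (simp add: Tr_def frob_diff sum_subtractf)

lemma Tr_0: "Tr 0 = 0"
  using Tr_diff[of 0 0] by simp

lemma Tr_scale: "c \<in> F \<Longrightarrow> Tr (c * x) = c * Tr x"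
  by (simp add: Tr_def power_mult_distrib F_power sum_distrib_left)

lemma Tr_frob: "Tr (x ^ q) = Tr x"
proof -
  have "Tr (x ^ q) = (\<Sum>l<s. x ^ (q ^ Suc l))" by (simp add: Tr_def mult.commute flip: power_mult)
  also have "\<dots> = Tr x"
    unfolding Tr_def by (rule sum_cyclic_shift[of "\<lambda>l. x ^ (q ^ l)"]) (use power_qs[of x 1] in simp)
  finally show ?thesis .
qed

lemma Tr_power: "Tr (x ^ (q ^ l)) = Tr x"
  by (induction l) (simp_all add: power_mult Tr_frob mult.commute[of q])

lemma Tr_F: "Tr x \<in> F"
proof -
  have "Tr x ^ q = Tr (x ^ q)"
    using frob_sum[of "\<lambda>l. x ^ (q ^ l)" "{..<s}" 1] by (simp add: Tr_def mult.commute flip: power_mult)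
  then show ?thesis by (simp add: F_def Tr_frob)
qed

text \<open>The trace is a nonzero polynomial of degree at most \<open>q ^ (s - 1)\<close>, too
  small to vanish on all \<open>q ^ s\<close> elements. A nonzero value lies in \<open>F\<close> and
  can be scaled to one.\<close>

lemma Tr_one: "\<exists>x. Tr x = 1"
proof -
  define P :: "'a poly" where "P = (\<Sum>l<s. monom 1 (q ^ l))"
  have "coeff P 1 = (\<Sum>l<s. if l = 0 then 1 else 0)"
    unfolding P_def coeff_sum using q_gt_1 by (intro sum.cong) auto
  then have "P \<noteq> 0" using s by auto
  have "degree P \<le> q ^ (s - 1)"
    unfolding P_def using q_gt_1
    by (intro degree_sum_le) (auto intro!: order_trans[OF degree_monom_le] power_increasing)
  also have "\<dots> < q ^ s" using q_gt_1 s by (intro power_strict_increasing) auto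
  finally have "card {x. poly P x = 0} < CARD('a)"
    using card_poly_roots_bound[OF \<open>P \<noteq> 0\<close>] CARD_a by linarith
  then have "{x. poly P x = 0} \<noteq> UNIV" by (metis less_irrefl)
  then obtain x where "poly P x \<noteq> 0" by blast
  then have "Tr x \<noteq> 0" by (simp add: P_def Tr_def poly_sum poly_monom)
  then have "Tr (inverse (Tr x) * x) = 1" using Tr_scale F_closed(3) Tr_F by simp
  then show ?thesis by blast
qed

text \<open>On the subfield of order \<open>q ^ n\<close> the functional \<open>w \<mapsto> Tr (c * w)\<close> only depends on the relative
  trace \<open>b\<close> of \<open>c\<close>, which lies in that subfield; so there are at most \<open>q ^ n\<close> such functionals.\<close>

lemma Tr_factor:
  fixes c w :: 'a
  assumes "n dvd s" "n > 0" "w ^ (q ^ n) = w"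
  defines "b \<equiv> \<Sum>u<s div n. c ^ (q ^ (n * u))"
  shows "Tr (c * w) = (\<Sum>l<n. (b * w) ^ (q ^ l))" "b ^ (q ^ n) = b"
proof -
  have s_eq: "s = (s div n) * n" using assms by simp
  have w: "w ^ (q ^ (n * u)) = w" for u
    by (induction u) (simp_all add: power_add power_mult assms(3))
  have bw: "b * w = (\<Sum>u<s div n. (c * w) ^ (q ^ (n * u)))"
    by (simp add: b_def power_mult_distrib w sum_distrib_right)
  \<comment> \<open>The exponents are grouped into blocks of length \<open>n\<close>; summing over
    the blocks first produces the relative trace.\<close>
  have "Tr (c * w) = (\<Sum>l<(s div n) * n. (c * w) ^ (q ^ l))"
    unfolding Tr_def using s_eq by simp
  also have "\<dots> = (\<Sum>u<s div n. \<Sum>l\<in>{u * n..<u * n + n}. (c * w) ^ (q ^ l))"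
    by (rule sum.nat_group[symmetric])
  also have "\<dots> = (\<Sum>u<s div n. \<Sum>l<n. ((c * w) ^ (q ^ (n * u))) ^ (q ^ l))"
  proof (rule sum.cong[OF refl])
    fix u
    have "(\<Sum>l\<in>{u * n..<u * n + n}. (c * w) ^ (q ^ l)) = (\<Sum>l<n. (c * w) ^ (q ^ (u * n + l)))"
      by (rule sum.reindex_bij_witness[of _ "\<lambda>l. u * n + l" "\<lambda>l. l - u * n"]) auto
    then show "(\<Sum>l\<in>{u * n..<u * n + n}. (c * w) ^ (q ^ l)) = (\<Sum>l<n. ((c * w) ^ (q ^ (n * u))) ^ (q ^ l))"
      by (simp add: power_add mult.commute[of u] power_mult)
  qed
  also have "\<dots> = (\<Sum>l<n. (b * w) ^ (q ^ l))"
    unfolding bw frob_sum by (rule sum.swap)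
  finally show "Tr (c * w) = (\<Sum>l<n. (b * w) ^ (q ^ l))" .
  have "b ^ (q ^ n) = (\<Sum>u<s div n. c ^ (q ^ (n * Suc u)))"
    unfolding b_def frob_sum by (simp add: power_add mult.commute flip: power_mult)
  also have "\<dots> = b"
    unfolding b_def using power_qs[of c 1] s_eq
    by (intro sum_cyclic_shift[of "\<lambda>u. c ^ (q ^ (n * u))"]) (simp add: mult.commute)
  finally show "b ^ (q ^ n) = b" .
qed

end

section \<open>Cyclotomic sets and the extended trace code\<close>

locale cyclotomic_extension = finite_extension p r q s ty
  for p r q s and ty :: "'a::{field,finite} itself" +
  fixes N :: nat
  assumes N_gt_1: "N > 1" and N_dvd: "N - 1 dvd q ^ s - 1" and p_dvd_N: "p dvd N"
begin

abbreviation Y :: "'a set" where "Y \<equiv> eval_points N"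

abbreviation rot :: "nat \<Rightarrow> nat" where "rot \<equiv> zn_mult N q"

abbreviation cyc :: "nat \<Rightarrow> nat set" where "cyc \<equiv> cyclotomic_set q N"

section \<open>The action of \<open>q\<close> on exponents\<close>

lemma zn_mult_less: "zn_mult N k z < N"
proof -
  have "(k * z) mod (N - 1) < N - 1" using N_gt_1 by simp
  then show ?thesis by (auto simp: zn_mult_def)
qed

lemma zn_mult_pos: "z > 0 \<Longrightarrow> zn_mult N k z > 0"
  using N_gt_1 by (simp add: zn_mult_def)

lemma zn_mult_mod: "z > 0 \<Longrightarrow> zn_mult N k z mod (N - 1) = (k * z) mod (N - 1)"
  by (simp add: zn_mult_def)

lemma zn_mult_comp: "zn_mult N k (zn_mult N l z) = zn_mult N (k * l) z"
proof (cases "z = 0")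
  case False
  obtain w where w_def: "w = zn_mult N l z" by simp
  have w: "w > 0" "w mod (N - 1) = (l * z) mod (N - 1)"
    unfolding w_def using False zn_mult_pos zn_mult_mod by auto
  have "(k * w) mod (N - 1) = (k * (w mod (N - 1))) mod (N - 1)" by (rule mod_mult_right_eq[symmetric])
  also have "\<dots> = (k * l * z) mod (N - 1)" unfolding w(2) by (simp only: mod_mult_right_eq mult.assoc)
  finally have "zn_mult N k w = zn_mult N (k * l) z"
    using w(1) False unfolding zn_mult_def by (simp only: neq0_conv[symmetric] if_False)
  then show ?thesis by (simp only: w_def)
qed (simp add: zn_mult_def)

lemma zn_mult_1: "z < N \<Longrightarrow> zn_mult N 1 z = z"
  using N_gt_1 by (cases "z = N - 1") (auto simp: zn_mult_def)

lemma funpow_rot: "z < N \<Longrightarrow> (rot ^^ i) z = zn_mult N (q ^ i) z"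
  by (induction i) (use zn_mult_1 in \<open>simp_all add: zn_mult_comp\<close>)

text \<open>Modulo \<open>N - 1\<close> the factor \<open>q ^ s\<close> is one.\<close>

lemma rot_period: "z < N \<Longrightarrow> (rot ^^ s) z = z"
proof -
  assume z: "z < N"
  obtain k where "q ^ s - 1 = (N - 1) * k" using N_dvd by auto
  moreover have "q ^ s > 0" using q_gt_1 by simp
  ultimately have "q ^ s * z = z + (N - 1) * (k * z)"
    by (metis Suc_diff_1 add.commute add_mult_distrib mult.assoc mult_1 plus_1_eq_Suc)
  then have "(q ^ s * z) mod (N - 1) = (1 * z) mod (N - 1)" by simp
  then have "zn_mult N (q ^ s) z = zn_mult N 1 z" by (simp only: zn_mult_def)
  then show ?thesis using z funpow_rot zn_mult_1 by simp
qed

lemma cyc_conv: "z < N \<Longrightarrow> cyc z = range (\<lambda>i. (rot ^^ i) z)"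
  by (simp add: cyclotomic_set_def funpow_rot)

lemma cyc_subset: "z < N \<Longrightarrow> cyc z \<subseteq> {..<N}"
  by (auto simp: cyclotomic_set_def zn_mult_less)

lemma cyc_finite: "z < N \<Longrightarrow> finite (cyc z)"
  using cyc_subset finite_subset by blast

lemma mem_cyc_self: "z < N \<Longrightarrow> z \<in> cyc z"
  unfolding cyc_conv by (rule range_eqI[of _ _ 0]) simp

lemma cyc_eq:
  assumes z: "z < N" and w: "w \<in> cyc z"
  shows "cyc w = cyc z"
proof -
  have sub: "cyc w \<subseteq> cyc z" if z: "z < N" and w: "w \<in> cyc z" for z w
  proof -
    obtain i where i: "w = (rot ^^ i) z" using z w by (auto simp: cyc_conv)
    have "w < N" using z w cyc_subset by blast
    moreover have "(rot ^^ j) w = (rot ^^ (j + i)) z" for j by (simp add: i funpow_add)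
    ultimately show ?thesis using z by (auto simp: cyc_conv)
  qed
  obtain i where i: "w = (rot ^^ i) z" using z w by (auto simp: cyc_conv)
  have "w < N" using z w cyc_subset by blast
  \<comment> \<open>Going on to the multiple \<open>s * i\<close> of the period leads from
    \<open>w\<close> back to \<open>z\<close>.\<close>
  have "(rot ^^ (s * i - i)) w = (rot ^^ (s * i - i + i)) z"
    unfolding i funpow_add by simp
  also have "s * i - i + i = s * i" using s by simp
  also have "(rot ^^ (s * i)) z = z" using funpow_mod_eq[OF rot_period[OF z], of "s * i"] by simp
  finally have "z \<in> cyc w" using \<open>w < N\<close> by (metis cyc_conv rangeI)
  then show ?thesis using sub[OF z w] sub[OF \<open>w < N\<close>] by blast
qed

lemma cyc_period:
  assumes "z < N"
  shows "card (cyc z) > 0" "card (cyc z) dvd s" "(rot ^^ card (cyc z)) z = z"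
  using funpow_orbit[of s rot z] rot_period[OF assms] s assms by (simp_all add: cyc_conv)

text \<open>Nonzero evaluation points satisfy \<open>y ^ (N - 1) = 1\<close>. At zero the exponents
  have to be positive because \<open>0 ^ 0 = 1\<close>, which is the reason for keeping the
  exponents \<open>0\<close> and \<open>N - 1\<close> apart.\<close>

lemma eval_point_power_cong:
  assumes y: "y \<in> Y" and e: "e mod (N - 1) = e' mod (N - 1)" "e > 0" "e' > 0"
  shows "y ^ e = y ^ e'"
proof (cases "y = 0")
  case True
  then show ?thesis using e by (simp add: power_0_left)
next
  case False
  have "y ^ (N - 1) * y = 1 * y" using y N_gt_1 power_minus_mult[of N y] by (simp add: eval_points_def)
  then have 1: "y ^ (N - 1) = 1" using False by simp
  have "y ^ e = y ^ (e mod (N - 1))" for e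
  proof -
    have "y ^ e = y ^ ((N - 1) * (e div (N - 1)) + e mod (N - 1))" by simp
    then show ?thesis by (simp only: power_add power_mult 1 power_one mult_1)
  qed
  then show ?thesis using e(1) by metis
qed

text \<open>Multiplying an exponent by \<open>q\<close> is Frobenius on the value, so a cyclotomic
  set collects the conjugates of one monomial.\<close>

lemma eval_point_rot: "y \<in> Y \<Longrightarrow> y ^ rot z = (y ^ z) ^ q"
proof (cases "z = 0")
  case False
  assume y: "y \<in> Y"
  have "y ^ rot z = y ^ (q * z)"
    by (rule eval_point_power_cong[OF y]) (use False zn_mult_mod zn_mult_pos q_gt_1 in auto)
  then show ?thesis by (simp add: mult.commute flip: power_mult)
qed (simp add: zn_mult_def)

lemma eval_point_funpow_rot: "y \<in> Y \<Longrightarrow> y ^ ((rot ^^ l) z) = (y ^ z) ^ (q ^ l)"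
  by (induction l) (simp_all add: eval_point_rot mult_ac flip: power_mult)

lemma card_Y: "card Y = N"
  by (rule card_eval_points) (use N_gt_1 N_dvd CARD_a in simp_all)

text \<open>The sum counts the nonzero points: it is \<open>N - 1\<close>, that is
  \<open>-1\<close>, because \<open>p\<close> divides \<open>N\<close>.\<close>

lemma power_sum_Y: "(\<Sum>y\<in>Y. y ^ (N - 1)) \<noteq> 0"
proof -
  have "(\<Sum>y\<in>Y. y ^ (N - 1)) = (\<Sum>y\<in>Y. if y = 0 then 0 else 1)"
  proof (rule sum.cong[OF refl])
    fix y assume y: "y \<in> Y"
    have "y ^ (N - 1) * y = 1 * y" using y N_gt_1 power_minus_mult[of N y] by (simp add: eval_points_def)
    then show "y ^ (N - 1) = (if y = 0 then 0 else 1)" using N_gt_1 by (auto simp: power_0_left)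
  qed
  also have "\<dots> = (\<Sum>y\<in>Y. 1 - (if y = 0 then 1 else 0))" by (intro sum.cong) auto
  also have "\<dots> = of_nat N - 1"
    using N_gt_1 by (simp add: sum_subtractf card_Y) (simp add: eval_points_def power_0_left)
  also have "of_nat N = (0 :: 'a)" using p_dvd_N by (simp add: of_nat_eq_0_iff_char_dvd CHAR_a)
  finally show ?thesis by simp
qed

end

text \<open>\<open>self_orth\<close> is the inclusion of the evaluation code in its dual, tested on
  pairs of monomials.\<close>

locale self_orthogonal_reps = cyclotomic_extension p r q s ty N
  for p r q s and ty :: "'a::{field,finite} itself" and N +
  fixes a :: "nat \<Rightarrow> nat" and z t :: nat
  assumes a_mono: "strict_mono_on {..z} a" and a_image: "a ` {..z} = minimal_reps q N" and t_le: "t \<le> z"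
    and self_orth: "\<lbrakk>i \<le> t; j \<le> t; e \<in> cyc (a i); e' \<in> cyc (a j)\<rbrakk> \<Longrightarrow> (\<Sum>y\<in>Y. y ^ e * y ^ e') = 0"
begin

definition m :: nat where "m = (\<Sum>i\<le>t. card (cyc (a i)))"

lemma a_rep:
  assumes "i \<le> z"
  shows "a i < N" "a i = Min (cyc (a i))"
proof -
  obtain w where w: "w < N" "a i = Min (cyc w)" using assms a_image by (auto simp: minimal_reps_def)
  have "Min (cyc w) \<in> cyc w" using w cyc_finite mem_cyc_self by (intro Min_in) auto
  then have "a i \<in> cyc w" using w by simp
  then show "a i < N" using cyc_subset[OF w(1)] by blast
  show "a i = Min (cyc (a i))" unfolding cyc_eq[OF w(1) \<open>a i \<in> cyc w\<close>] by (rule w(2))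
qed

lemma rep_exists:
  assumes "e < N"
  shows "\<exists>i\<le>z. a i \<le> e \<and> e \<in> cyc (a i)"
proof -
  have "Min (cyc e) \<in> a ` {..z}" using assms by (auto simp: a_image minimal_reps_def)
  then obtain i where i: "i \<le> z" "a i = Min (cyc e)" by auto
  have "a i \<in> cyc e"
    unfolding i(2) using mem_cyc_self[OF assms] by (intro Min_in cyc_finite[OF assms]) blast
  then have "cyc (a i) = cyc e" by (rule cyc_eq[OF assms])
  moreover have "a i \<le> e"
    unfolding i(2) by (rule Min_le[OF cyc_finite[OF assms] mem_cyc_self[OF assms]])
  ultimately show ?thesis using i(1) mem_cyc_self[OF assms] by blast
qed

lemma cyc_disjoint:
  assumes "i \<le> z" "j \<le> z" "i \<noteq> j"
  shows "cyc (a i) \<inter> cyc (a j) = {}"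
proof (rule ccontr)
  assume "cyc (a i) \<inter> cyc (a j) \<noteq> {}"
  then obtain e where "e \<in> cyc (a i)" "e \<in> cyc (a j)" by blast
  then have "cyc (a i) = cyc (a j)"
    using cyc_eq[OF a_rep(1)[OF assms(1)]] cyc_eq[OF a_rep(1)[OF assms(2)]] by blast
  then have "a i = a j" using a_rep(2)[OF assms(1)] a_rep(2)[OF assms(2)] by argo
  then show False using strict_mono_on_eqD[OF a_mono, of i j] assms by simp
qed

text \<open>An exponent below \<open>a t\<close> lies in the cyclotomic set of a still smaller
  representative, hence of an index below \<open>t\<close>. That only \<open>a t\<close> itself has
  index \<open>t\<close>, at level zero, later allows the value at infinity to be
  prescribed.\<close>

lemma small_exponent:
  assumes "e \<le> a t"
  shows "\<exists>i\<le>t. \<exists>l. e = (rot ^^ l) (a i) \<and> (i = t \<longleftrightarrow> e = a t) \<and> (e = a t \<longrightarrow> l = 0)"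
proof (cases "e = a t")
  case True
  show ?thesis by (rule exI[of _ t], rule conjI[OF le_refl], rule exI[of _ 0]) (use True in simp)
next
  case False
  have "e < N" using assms a_rep(1)[OF t_le] by simp
  then obtain i where i: "i \<le> z" "a i \<le> e" "e \<in> cyc (a i)" using rep_exists by blast
  then have "a i < a t" using assms False by simp
  then have "i < t"
    using strict_mono_onD[OF a_mono, of t i] i(1) t_le by (cases i t rule: linorder_cases) auto
  moreover obtain l where l: "e = (rot ^^ l) (a i)" using i a_rep(1) by (auto simp: cyc_conv)
  ultimately show ?thesis
    by (intro exI[of _ i]) (use False in \<open>auto intro: exI[of _ l]\<close>)
qed

text \<open>Exponents \<open>e\<close> and \<open>N - 1 - e\<close> cannot both occur, as
  \<open>power_sum_Y\<close> would contradict orthogonality; so \<open>D\<close> and its mirror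
  image are disjoint subsets of \<open>{..<N}\<close>.\<close>

lemma twice_m_le: "2 * m \<le> N"
proof -
  define D where "D = (\<Union>i\<le>t. cyc (a i))"
  have D: "D \<subseteq> {..<N}" using cyc_subset a_rep(1) t_le unfolding D_def by (meson UN_least atMost_iff order_trans)
  have "card D = m"
    unfolding D_def m_def using t_le cyc_disjoint cyc_finite a_rep(1)
    by (intro card_UN_disjoint) auto
  have "N - 1 - e \<notin> D" if "e \<in> D" for e
  proof
    assume "N - 1 - e \<in> D"
    then have "(\<Sum>y\<in>Y. y ^ e * y ^ (N - 1 - e)) = 0" using that self_orth by (auto simp: D_def)
    moreover have "e + (N - 1 - e) = N - 1" using that D by auto
    ultimately show False using power_sum_Y by (simp flip: power_add)
  qed
  then have disj: "D \<inter> (\<lambda>e. N - 1 - e) ` D = {}" by auto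
  have "inj_on (\<lambda>e. N - 1 - e) D"
  proof (rule inj_onI)
    fix x y assume "x \<in> D" "y \<in> D" and eq: "N - 1 - x = N - 1 - y"
    then have "x < N" "y < N" using D by auto
    then show "x = y" using eq by linarith
  qed
  then have "card ((\<lambda>e. N - 1 - e) ` D) = m" using \<open>card D = m\<close> by (simp add: card_image)
  moreover have "finite D" using D finite_subset by blast
  ultimately have "card (D \<union> (\<lambda>e. N - 1 - e) ` D) = 2 * m"
    using disj \<open>card D = m\<close> by (simp add: card_Un_disjoint)
  moreover have "card (D \<union> (\<lambda>e. N - 1 - e) ` D) \<le> card {..<N}"
    by (rule card_mono) (use D N_gt_1 in auto)
  ultimately show ?thesis by simp
qed

lemma m_pos: "m \<ge> 1"
proof -
  have "card (cyc (a t)) \<le> m" unfolding m_def by (rule member_le_sum) auto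
  then show ?thesis using cyc_period(1)[OF a_rep(1)[OF t_le]] by simp
qed

section \<open>The extended trace code: size, dual, inner products and projections\<close>

definition pt :: "nat \<Rightarrow> 'a" where "pt = (SOME h. bij_betw h {..<N} Y)"

lemma pt: "bij_betw pt {..<N} Y"
  unfolding pt_def
  by (rule someI_ex[of "\<lambda>h. bij_betw h {..<N} Y"]) (use ex_bij_betw_nat_finite[of Y] card_Y in \<open>simp add: atLeast0LessThan\<close>)

lemma pt_Y: "i < N \<Longrightarrow> pt i \<in> Y"
  using pt by (auto simp: bij_betw_def)

text \<open>Coordinate \<open>N\<close> is the point at infinity.\<close>

definition row :: "(nat \<Rightarrow> 'a) \<Rightarrow> nat \<Rightarrow> 'a" where
  "row c i = (if i < N then Tr (\<Sum>j\<le>t. c j * pt i ^ a j) else if i = N then Tr (c t) else 0)"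

text \<open>For \<open>v\<close> over \<open>F\<close> the inner product with \<open>row c\<close>
  is the trace of \<open>\<Sum>j\<le>t. c j * syndrome v j\<close>, so a zero syndrome puts
  \<open>v\<close> into the dual.\<close>

definition syndrome :: "(nat \<Rightarrow> 'a) \<Rightarrow> nat \<Rightarrow> 'a" where
  "syndrome v j = (if j \<le> t then (\<Sum>i<N. v i * pt i ^ a j) + (if j = t then v N else 0) else 0)"

text \<open>For \<open>j \<le> t\<close> this is a fixed field of Frobenius that contains the values
  \<open>pt i ^ a j\<close>; the relative traces of the coefficients and the syndromes of vectors
  over \<open>F\<close> lie in it.\<close>

definition K :: "nat \<Rightarrow> 'a set" where "K j = {x. x ^ (q ^ card (cyc (a j))) = x}"

lemma card_PiE_K: "card (PiE {..t} K) \<le> q ^ m"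
proof -
  have "card (PiE {..t} K) = (\<Prod>j\<le>t. card (K j))" by (simp add: card_PiE)
  also have "\<dots> \<le> (\<Prod>j\<le>t. q ^ card (cyc (a j)))"
  proof (rule prod_mono)
    fix j assume "j \<in> {..t}"
    then have "card (cyc (a j)) > 0" using cyc_period(1)[OF a_rep(1)] t_le by simp
    then have "q ^ card (cyc (a j)) > 1" using one_less_power q_gt_1 by blast
    then show "0 \<le> card (K j) \<and> card (K j) \<le> q ^ card (cyc (a j))"
      unfolding K_def using card_power_fixed_le by blast
  qed
  also have "\<dots> = q ^ m" by (simp add: m_def power_sum)
  finally show ?thesis .
qed

lemma point_period:
  assumes "i < N" "j \<le> t"
  shows "(pt i ^ a j) ^ (q ^ card (cyc (a j))) = pt i ^ a j"
proof -
  have "(rot ^^ card (cyc (a j))) (a j) = a j"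
    by (rule cyc_period(3)[OF a_rep(1)]) (use assms t_le in simp)
  then show ?thesis
    using eval_point_funpow_rot[OF pt_Y[OF assms(1)], of "card (cyc (a j))" "a j"] by argo
qed

lemma row_vecs: "range row \<subseteq> vecs (N + 1) F"
  by (auto simp: vecs_def row_def Tr_F)

lemma row_diff: "row (c - d) = row c - row d"
proof
  show "row (c - d) i = (row c - row d) i" for i
    by (simp add: row_def Tr_diff left_diff_distrib sum_subtractf)
qed

lemma diff_closed_row: "diff_closed (range row)"
proof -
  have "row 0 = 0" using row_diff[of 0 0] by simp
  then have "0 \<in> range row" by (metis rangeI)
  moreover have "row c - row d \<in> range row" for c d
    using rangeI[of row "c - d"] by (simp only: row_diff)
  ultimately show ?thesis unfolding diff_closed_def by blast
qed

text \<open>By \<open>Tr_factor\<close> a row depends on each \<open>c j\<close> only through its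
  relative trace \<open>b j\<close> in \<open>K j\<close>, so there are at most as many rows as
  elements in the product of these fields.\<close>

lemma card_row: "card (range row) \<le> q ^ m"
proof -
  define G where "G b i = (if i < N then \<Sum>j\<le>t. \<Sum>l<card (cyc (a j)). (b j * pt i ^ a j) ^ (q ^ l)
    else if i = N then \<Sum>l<card (cyc (a t)). b t ^ (q ^ l) else 0)" for b :: "nat \<Rightarrow> 'a" and i
  have "row c \<in> G ` PiE {..t} K" for c
  proof
    define b where "b = (\<lambda>j\<in>{..t}. \<Sum>u<s div card (cyc (a j)). c j ^ (q ^ (card (cyc (a j)) * u)))"
    have per: "card (cyc (a j)) dvd s" "card (cyc (a j)) > 0" if "j \<le> t" for j
      using cyc_period a_rep(1) that t_le by auto
    have Tr_w: "Tr (c j * w) = (\<Sum>l<card (cyc (a j)). (b j * w) ^ (q ^ l))"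
      if "j \<le> t" "w ^ (q ^ card (cyc (a j))) = w" for j w
      using Tr_factor(1)[OF per[OF that(1)] that(2), of "c j"] that(1) by (simp add: b_def)
    have "b j \<in> K j" if "j \<le> t" for j
      using Tr_factor(2)[OF per[OF that], of 1 "c j"] that by (simp add: b_def K_def)
    then show "b \<in> PiE {..t} K" by (simp add: b_def PiE_iff)
    show "row c = G b"
    proof
      fix i
      show "row c i = G b i"
      proof (cases "i < N")
        case True
        have "row c i = (\<Sum>j\<le>t. Tr (c j * pt i ^ a j))" using True by (simp add: row_def Tr_sum)
        also have "\<dots> = (\<Sum>j\<le>t. \<Sum>l<card (cyc (a j)). (b j * pt i ^ a j) ^ (q ^ l))"
          by (rule sum.cong[OF refl]) (simp add: Tr_w[OF _ point_period[OF True]])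
        finally show ?thesis using True by (simp add: G_def)
      next
        case False
        \<comment> \<open>The coordinate at infinity is the case \<open>w = 1\<close>.\<close>
        then show ?thesis using Tr_w[of t 1] by (simp add: row_def G_def)
      qed
    qed
  qed
  then have "range row \<subseteq> G ` PiE {..t} K" by auto
  moreover have "finite (PiE {..t} K)" by (intro finite_PiE) auto
  ultimately show ?thesis
    using card_PiE_K surj_card_le[of "PiE {..t} K" "range row" G] by linarith
qed

text \<open>On vectors over \<open>F\<close> the syndrome is additive with values in the product of
  the \<open>K j\<close>, so it takes at most \<open>q ^ m\<close> values and its kernel has at
  least \<open>q ^ (N + 1 - m)\<close> elements. The kernel lies in the dual.\<close>

lemma card_dual_row: "q ^ (N + 1 - m) \<le> card (dual (N + 1) F (range row))"
proof -
  let ?V = "vecs (N + 1) F"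
  have fin: "finite ?V" by (intro finite_vecs) simp
  have hom: "syndrome (v - w) = syndrome v - syndrome w" for v w
    by (auto simp: fun_eq_iff syndrome_def left_diff_distrib sum_subtractf)
  have "syndrome v j \<in> K j" if "v \<in> ?V" "j \<le> t" for v j
  proof -
    have "v i ^ (q ^ card (cyc (a j))) = v i" if "i \<le> N" for i
      using \<open>v \<in> ?V\<close> that by (intro F_power) (auto simp: vecs_def)
    moreover have "q \<noteq> 0" using q_gt_1 by simp
    ultimately show ?thesis using that(2)
      by (cases "j = t")
        (simp_all add: syndrome_def K_def frob_add frob_sum power_mult_distrib point_period power_0_left)
  qed
  then have "(\<lambda>f. restrict f {..t}) ` syndrome ` ?V \<subseteq> PiE {..t} K"
    by (intro subsetI, elim imageE) (simp add: restrict_PiE_iff)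
  then have "card ((\<lambda>f. restrict f {..t}) ` syndrome ` ?V) \<le> card (PiE {..t} K)"
    by (intro card_mono finite_PiE) auto
  \<comment> \<open>Functions in \<open>PiE\<close> are undefined rather than zero beyond
    \<open>t\<close>; the restriction adapts the syndromes to this and loses nothing.\<close>
  moreover have "inj_on (\<lambda>f. restrict f {..t}) (syndrome ` ?V)"
  proof (rule inj_onI, elim imageE, rule ext)
    fix f g v w j assume eq: "restrict f {..t} = restrict g {..t}" "f = syndrome v" "g = syndrome w"
    show "f j = g j"
    proof (cases "j \<le> t")
      case True
      then show ?thesis using fun_cong[OF eq(1), of j] by simp
    qed (simp add: eq syndrome_def)
  qed
  ultimately have "card (syndrome ` ?V) \<le> q ^ m" using card_PiE_K by (simp add: card_image)
  moreover have "q ^ (N + 1) = card {v \<in> ?V. syndrome v = 0} * card (syndrome ` ?V)"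
    using card_kernel_image[OF fin diff_closed_vecs[OF F_closed(1)], of syndrome] hom
      card_vecs[of F "N + 1"] card_F by simp
  ultimately have "q ^ (N + 1) \<le> card {v \<in> ?V. syndrome v = 0} * q ^ m" by simp
  moreover have "N + 1 - m + m = N + 1" using twice_m_le by simp
  then have "q ^ (N + 1) = q ^ (N + 1 - m) * q ^ m" by (simp only: power_add[symmetric])
  ultimately have "q ^ (N + 1 - m) * q ^ m \<le> card {v \<in> ?V. syndrome v = 0} * q ^ m" by (simp only:)
  then have "q ^ (N + 1 - m) \<le> card {v \<in> ?V. syndrome v = 0}" using q_gt_1 by simp
  also have "\<dots> \<le> card (dual (N + 1) F (range row))"
  proof (rule card_mono)
    show "finite (dual (N + 1) F (range row))"
      using fin by (auto simp: dual_def)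
    have "dot (N + 1) v (row c) = 0" if v: "v \<in> ?V" and "syndrome v = 0" for v c
    proof -
      have vF: "v i \<in> F" if "i \<le> N" for i using v that by (auto simp: vecs_def)
      have "dot (N + 1) v (row c) = Tr ((\<Sum>i<N. v i * (\<Sum>j\<le>t. c j * pt i ^ a j)) + v N * c t)"
        by (simp add: dot_def row_def Tr_add Tr_sum[of _ "{..<N}"] Tr_scale vF)
      also have "(\<Sum>i<N. v i * (\<Sum>j\<le>t. c j * pt i ^ a j)) + v N * c t = (\<Sum>j\<le>t. c j * syndrome v j)"
      proof -
        have "(\<Sum>j\<le>t. c j * syndrome v j) = (\<Sum>j\<le>t. c j * (\<Sum>i<N. v i * pt i ^ a j)) + (\<Sum>j\<le>t. if j = t then c t * v N else 0)"
          unfolding sum.distrib[symmetric] by (intro sum.cong) (auto simp: syndrome_def distrib_left)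
        also have "(\<Sum>j\<le>t. c j * (\<Sum>i<N. v i * pt i ^ a j)) = (\<Sum>i<N. v i * (\<Sum>j\<le>t. c j * pt i ^ a j))"
          unfolding sum_distrib_left by (subst sum.swap) (simp add: mult_ac)
        finally show ?thesis by (simp add: mult.commute)
      qed
      also have "\<dots> = 0" using that(2) by (simp add: fun_eq_iff)
      finally show ?thesis by (simp add: Tr_0)
    qed
    then show "{v \<in> ?V. syndrome v = 0} \<subseteq> dual (N + 1) F (range row)" by (auto simp: dual_def)
  qed
  finally show ?thesis .
qed

text \<open>The traces expand into conjugate monomials with exponents in the sets
  \<open>cyc (a j)\<close>, \<open>j \<le> t\<close>. All pairs of these are orthogonal, and only
  the product at infinity survives.\<close>

lemma row_dot: "dot (N + 1) (row c) (row d) = row c N * row d N"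
proof -
  let ?I = "{..<s} \<times> {..t}"
  let ?e = "\<lambda>(l, j). (rot ^^ l) (a j)"
  have expand: "Tr (\<Sum>j\<le>t. c j * y ^ a j) = (\<Sum>u\<in>?I. c (snd u) ^ (q ^ fst u) * y ^ ?e u)" if "y \<in> Y" for y c
    using that by (simp add: Tr_def frob_sum power_mult_distrib eval_point_funpow_rot sum.cartesian_product case_prod_unfold)
  have mem: "snd u \<le> t" "?e u \<in> cyc (a (snd u))" if "u \<in> ?I" for u
    using that a_rep(1) t_le by (auto simp: cyc_conv)
  have orth: "(\<Sum>y\<in>Y. y ^ ?e u * y ^ ?e v) = 0" if "u \<in> ?I" "v \<in> ?I" for u v
    by (rule self_orth[OF mem(1) mem(1) mem(2) mem(2)]) (use that in simp_all)
  have "(\<Sum>i<N. row c i * row d i) = (\<Sum>y\<in>Y. Tr (\<Sum>j\<le>t. c j * y ^ a j) * Tr (\<Sum>j\<le>t. d j * y ^ a j))"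
    using sum.reindex_bij_betw[OF pt, of "\<lambda>y. Tr (\<Sum>j\<le>t. c j * y ^ a j) * Tr (\<Sum>j\<le>t. d j * y ^ a j)"]
    by (simp add: row_def)
  also have "\<dots> = (\<Sum>y\<in>Y. \<Sum>u\<in>?I. \<Sum>v\<in>?I. c (snd u) ^ (q ^ fst u) * d (snd v) ^ (q ^ fst v) * (y ^ ?e u * y ^ ?e v))"
    by (intro sum.cong refl) (simp only: expand sum_product mult_ac)
  also have "\<dots> = (\<Sum>u\<in>?I. \<Sum>v\<in>?I. c (snd u) ^ (q ^ fst u) * d (snd v) ^ (q ^ fst v) * (\<Sum>y\<in>Y. y ^ ?e u * y ^ ?e v))"
    unfolding sum_distrib_left by (subst sum.swap, intro sum.cong refl, rule sum.swap)
  also have "\<dots> = 0" by (intro sum.neutral ballI) (simp only: orth mult_zero_right)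
  finally show ?thesis by (simp add: dot_def)
qed

text \<open>A polynomial of degree at most \<open>a t\<close> interpolates
  \<open>\<theta> * w\<close>, where \<open>\<theta>\<close> has trace one. Each of its monomials is
  conjugate to one whose exponent is some \<open>a j\<close>, and conjugation does not alter the
  trace.\<close>

lemma row_onto:
  assumes S: "S \<subseteq> {..<N + 1}" "card S < a t + 2" and w: "w \<in> vecs (N + 1) F"
  shows "\<exists>v\<in>range row. \<forall>i\<in>S. v i = w i"
proof -
  obtain \<theta> where \<theta>: "Tr \<theta> = 1" using Tr_one by blast
  have wF: "w i \<in> F" if "i \<le> N" for i using w that by (auto simp: vecs_def)
  have finS: "finite S" using S finite_subset by blast
  define idx where "idx = inv_into {..<N} pt"
  have idx: "idx (pt i) = i" if "i < N" for i
    using pt that by (simp add: idx_def bij_betw_def)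
  have "\<exists>g. (\<forall>i\<in>S. i < N \<longrightarrow> (\<Sum>e\<le>a t. g e * pt i ^ e) = \<theta> * w i) \<and> (N \<in> S \<longrightarrow> g (a t) = \<theta> * w N)"
  proof (cases "N \<in> S")
    case True
    have "card (S - {N}) \<le> a t" using S(2) True finS by simp
    then have "card (pt ` (S - {N})) \<le> a t" using card_image_le[of "S - {N}" pt] finS by simp
    \<comment> \<open>With infinity in \<open>S\<close> the leading coefficient is prescribed;
      moving its term to the other side leaves \<open>a t\<close> coefficients for at most
      \<open>a t\<close> points.\<close>
    then obtain g where g: "\<forall>x\<in>pt ` (S - {N}). (\<Sum>e<a t. g e * x ^ e) = \<theta> * w (idx x) - \<theta> * w N * x ^ a t"
      using interpolation[of "pt ` (S - {N})" "a t" "\<lambda>x. \<theta> * w (idx x) - \<theta> * w N * x ^ a t"] finS by auto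
    show ?thesis
    proof (intro exI[of _ "g(a t := \<theta> * w N)"] conjI ballI impI)
      fix i assume i: "i \<in> S" "i < N"
      have "(\<Sum>e\<le>a t. (g(a t := \<theta> * w N)) e * pt i ^ e) = (\<Sum>e<a t. g e * pt i ^ e) + \<theta> * w N * pt i ^ a t"
        by (simp flip: lessThan_Suc_atMost)
      then show "(\<Sum>e\<le>a t. (g(a t := \<theta> * w N)) e * pt i ^ e) = \<theta> * w i" using g i idx by auto
    qed simp
  next
    case False
    have "card (pt ` S) \<le> Suc (a t)" using card_image_le[OF finS, of pt] S(2) by simp
    then obtain g where g: "\<forall>x\<in>pt ` S. (\<Sum>e<Suc (a t). g e * x ^ e) = \<theta> * w (idx x)"
      using interpolation[of "pt ` S" "Suc (a t)" "\<lambda>x. \<theta> * w (idx x)"] finS by auto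
    then show ?thesis using False idx by (intro exI[of _ g]) (auto simp: lessThan_Suc_atMost)
  qed
  then obtain g where g: "\<And>i. i \<in> S \<Longrightarrow> i < N \<Longrightarrow> (\<Sum>e\<le>a t. g e * pt i ^ e) = \<theta> * w i"
    and gN: "N \<in> S \<Longrightarrow> g (a t) = \<theta> * w N" by blast
  obtain \<iota> lev where \<iota>: "\<And>e. e \<le> a t \<Longrightarrow> \<iota> e \<le> t" "\<And>e. e \<le> a t \<Longrightarrow> e = (rot ^^ lev e) (a (\<iota> e))"
    "\<And>e. e \<le> a t \<Longrightarrow> \<iota> e = t \<longleftrightarrow> e = a t" "lev (a t) = 0"
    using small_exponent by (metis order_refl)
  \<comment> \<open>With such a root \<open>d e\<close>, the monomial \<open>g e * y ^ e\<close> is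
    a Frobenius power of \<open>d e * y ^ a (\<iota> e)\<close> at every evaluation point.\<close>
  have "\<forall>e. \<exists>y :: 'a. y ^ (q ^ lev e) = g e" using frob_surj by blast
  then obtain d :: "nat \<Rightarrow> 'a" where d: "\<And>e. d e ^ (q ^ lev e) = g e"
    using choice[of "\<lambda>e y. y ^ (q ^ lev e) = g e"] by blast
  define c where "c j = (\<Sum>e\<in>{e \<in> {..a t}. \<iota> e = j}. d e)" for j
  have "row c i = w i" if i: "i \<in> S" for i
  proof (cases "i < N")
    case True
    have "Tr (\<Sum>j\<le>t. c j * pt i ^ a j) = Tr (\<Sum>j\<le>t. \<Sum>e\<in>{e \<in> {..a t}. \<iota> e = j}. d e * pt i ^ a (\<iota> e))"
      by (intro arg_cong[where f = Tr] sum.cong refl) (simp add: c_def sum_distrib_right)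
    also have "\<dots> = (\<Sum>e\<le>a t. Tr (d e * pt i ^ a (\<iota> e)))"
      using \<iota>(1) by (subst sum.group) (auto simp: Tr_sum)
    also have "\<dots> = (\<Sum>e\<le>a t. Tr (g e * pt i ^ e))"
    proof (rule sum.cong[OF refl])
      fix e assume "e \<in> {..a t}"
      then have "pt i ^ e = (pt i ^ a (\<iota> e)) ^ (q ^ lev e)"
        using \<iota>(2)[of e] eval_point_funpow_rot[OF pt_Y[OF True], of "lev e" "a (\<iota> e)"] by simp
      then have "g e * pt i ^ e = (d e * pt i ^ a (\<iota> e)) ^ (q ^ lev e)" by (simp add: power_mult_distrib d)
      then show "Tr (d e * pt i ^ a (\<iota> e)) = Tr (g e * pt i ^ e)" by (simp add: Tr_power)
    qed
    also have "\<dots> = Tr (w i * \<theta>)" using g[OF i True] by (simp add: mult.commute flip: Tr_sum)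
    also have "\<dots> = w i" using Tr_scale[OF wF] True \<theta> by simp
    finally show ?thesis using True by (simp add: row_def)
  next
    case False
    then have "i = N" using S i by auto
    \<comment> \<open>Only the leading exponent has index \<open>t\<close>, and its level is zero,
      so \<open>c t\<close> is the leading coefficient itself.\<close>
    have "{e \<in> {..a t}. \<iota> e = t} = {a t}" using \<iota>(3) by auto
    then have "c t = \<theta> * w N" using d[of "a t"] \<iota>(4) gN i \<open>i = N\<close> by (simp add: c_def)
    then have "Tr (c t) = w N" using Tr_scale[OF wF, of N \<theta>] \<theta> by (simp add: mult.commute)
    then show ?thesis using \<open>i = N\<close> by (simp add: row_def)
  qed
  then show ?thesis by blast
qed

text \<open>The code has length \<open>N + 1\<close> with infinity as the coordinate
  \<open>l\<close>; the second \<open>+ 1\<close> in the dimension comes from the single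
  pair.\<close>

lemma eaqecc_exists_params:
  assumes "CARD('b::{finite,zero}) = q"
  shows "\<exists>Q :: 'b qvec set. eaqecc_params (N + 1) (N + 1 + 1 - 2 * m) (a t + 2) 1 Q"
proof -
  have dot: "dot (N + 1) x y = x N * y N" if "x \<in> range row" "y \<in> range row" for x y
    using that by (elim rangeE) (simp only: row_dot)
  have "card F = CARD('b)" "N < N + 1" "1 < a t + 2" using assms card_F by simp_all
  moreover have "card (range row) \<le> CARD('b) ^ m"
    "CARD('b) ^ (N + 1 - m) \<le> card (dual (N + 1) F (range row))"
    unfolding assms by (rule card_row card_dual_row)+
  moreover have "m \<le> N + 1" "2 * m \<le> N + 1 + 1" using twice_m_le by simp_all
  ultimately show ?thesis
    using eaqecc_from_code[OF _ F_closed(1,2) row_vecs diff_closed_row _ dot row_onto] m_pos by blast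
qed

end

theorem theorem5p5:
  fixes p r q s N z t :: nat
    and a :: "nat \<Rightarrow> nat"
    and \<Delta> \<Delta>'' :: "nat set"
  assumes "prime p" and "r \<ge> 1" and "q = p ^ r"
    and "s \<ge> 1"
    and "CARD('a::{field,finite}) = q ^ s"
    and "CARD('b::{field,finite}) = q"
    and "N > 1" and "N - 1 dvd q ^ s - 1" and "p dvd N"
    and "a 0 = 0" and "strict_mono_on {..z} a" and "a ` {..z} = minimal_reps q N"
    and "t \<le> z"
    and "\<Delta> = (\<Union>i<t. cyclotomic_set q N (a i)) \<union> {a t}"
    and "\<Delta>'' = (\<Union>i\<le>t. cyclotomic_set q N (a i))"
    and "(RS N \<Delta>'' :: ('a \<Rightarrow> 'a) set) \<subseteq> euclidean_dual N (RS N \<Delta>'')"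
  shows "\<exists>(\<kappa>::nat) (c::nat) (Q :: 'b qvec set).
           c \<le> 1 \<and>
           int \<kappa> = int (N + 1) - 2 * (\<Sum>i\<le>t. int (card (cyclotomic_set q N (a i)))) + int c \<and>
           eaqecc_params (N + 1) \<kappa> (a t + 2) c Q"
proof -
  interpret module "\<lambda>c (f :: 'a \<Rightarrow> 'a) y. c * f y"
    by unfold_locales (simp_all add: fun_eq_iff distrib_left distrib_right mult.assoc)
  \<comment> \<open>Self-orthogonality is applied to the generating vectors of the code.\<close>
  have orth: "(\<Sum>y\<in>eval_points N. y ^ e * y ^ e') = (0 :: 'a)" if "e \<in> \<Delta>''" "e' \<in> \<Delta>''" for e e'
  proof -
    have "monomial_vec N e \<in> (RS N \<Delta>'' :: ('a \<Rightarrow> 'a) set)" "monomial_vec N e' \<in> (RS N \<Delta>'' :: ('a \<Rightarrow> 'a) set)"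
      unfolding RS_def using that by (auto intro!: span_base)
    then have "(\<Sum>y\<in>eval_points N. monomial_vec N e y * monomial_vec N e' y) = (0 :: 'a)"
      using assms(16) by (auto simp: euclidean_dual_def)
    then show ?thesis by (simp add: monomial_vec_def)
  qed
  have "(\<Sum>y\<in>eval_points N. y ^ e * y ^ e') = (0 :: 'a)"
    if "i \<le> t" "j \<le> t" "e \<in> cyclotomic_set q N (a i)" "e' \<in> cyclotomic_set q N (a j)" for i j e e'
    by (rule orth) (use that in \<open>auto simp: assms(15)\<close>)
  then interpret self_orthogonal_reps p r q s "TYPE('a)" N a z t
    using assms by unfold_locales
  obtain Q :: "'b qvec set" where Q: "eaqecc_params (N + 1) (N + 1 + 1 - 2 * m) (a t + 2) 1 Q"
    using eaqecc_exists_params assms(6) by blast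
  \<comment> \<open>The subtraction of natural numbers is exact since
    \<open>2 * m \<le> N\<close>.\<close>
  have "int (N + 1 + 1 - 2 * m) = int (N + 1) - 2 * (\<Sum>i\<le>t. int (card (cyclotomic_set q N (a i)))) + int 1"
    using twice_m_le by (simp add: m_def of_nat_diff)
  then show ?thesis using Q by blast
qed

end
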